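(* Let $K$ be a field and let $\mathcal{S}$ be a finitely generated semigroup (under composition) of polynomials in $K[x]$ such that $\mathrm{char}\,K$ does not divide the degree of any element of $\mathcal{S}$. Then either $\mathcal{S}$ has polynomially bounded growth or $\mathcal{S}$ contains a nonabelian free semigroup.
   Context: For a semigroup $\mathcal{S}$ with finite generating set $S$, let $d_S(n)$ be the number of distinct elements of $\mathcal{S}$ expressible as a composition of at most $n$ elements of $S$. $\mathcal{S}$ has polynomially bounded growth if $d_S(n)=O(n^\kappa)$ for some $\kappa>0$ (independent of the finite generating set). $\mathcal{S}$ contains a nonabelian free semigroup if it contains a subsemigroup that is free on two generators. (Characteristic $0$ is regarded as dividing no positive integer.) *)

theory Defs
  imports
    "HOL-Computational_Algebra.Computational_Algebra"
    "HOL-Library.Landau_Symbols"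
begin

text \<open>
  Semigroups are sets closed under an associative operation \<open>op\<close> on the ambient type
  (below, \<^const>\<open>pcompose\<close>). As for semigroups in general, no identity is assumed, so only
  nonempty products are formed.
\<close>

definition subsemigroup :: "('s \<Rightarrow> 's \<Rightarrow> 's) \<Rightarrow> 's set \<Rightarrow> bool" where
  "subsemigroup op S \<longleftrightarrow> (\<forall>x\<in>S. \<forall>y\<in>S. op x y \<in> S)"

definition generates :: "('s \<Rightarrow> 's \<Rightarrow> 's) \<Rightarrow> 's set \<Rightarrow> 's set \<Rightarrow> bool" where
  "generates op G S \<longleftrightarrow> S = subsemigroup op hull G"

fun word_prod :: "('s \<Rightarrow> 's \<Rightarrow> 's) \<Rightarrow> 's list \<Rightarrow> 's" where
  "word_prod op [x] = x"
| "word_prod op (x # y # ws) = op x (word_prod op (y # ws))"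

definition nonempty_words :: "'s set \<Rightarrow> 's list set" where
  "nonempty_words A = {ws. ws \<noteq> [] \<and> set ws \<subseteq> A}"

definition growth :: "('s \<Rightarrow> 's \<Rightarrow> 's) \<Rightarrow> 's set \<Rightarrow> nat \<Rightarrow> nat" where
  "growth op G n = card (word_prod op ` {ws \<in> nonempty_words G. length ws \<le> n})"

text \<open>
  The exponent is required to work for all finite generating sets at once. The notion is meant
  for finitely generated \<open>S\<close> only.
\<close>

definition polynomially_bounded_growth :: "('s \<Rightarrow> 's \<Rightarrow> 's) \<Rightarrow> 's set \<Rightarrow> bool" where
  "polynomially_bounded_growth op S \<longleftrightarrow>
     (\<exists>\<kappa>>0. \<forall>G. finite G \<and> generates op G S \<longrightarrow>
        (\<lambda>n. real (growth op G n)) \<in> O(\<lambda>n. real n powr \<kappa>))"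

definition free_semigroup_on :: "('s \<Rightarrow> 's \<Rightarrow> 's) \<Rightarrow> 's set \<Rightarrow> 's set \<Rightarrow> bool" where
  "free_semigroup_on op A T \<longleftrightarrow> bij_betw (word_prod op) (nonempty_words A) T"

definition contains_nonabelian_free_semigroup :: "('s \<Rightarrow> 's \<Rightarrow> 's) \<Rightarrow> 's set \<Rightarrow> bool" where
  "contains_nonabelian_free_semigroup op S \<longleftrightarrow>
     (\<exists>T A. T \<subseteq> S \<and> subsemigroup op T \<and> card A = 2 \<and> free_semigroup_on op A T)"

end

theory Submission
  imports Defs
begin

text \<open>
  Words containing a constant contribute at most a bounded factor to the growth, so assume that all
  elements are nonconstant.

  Suppose some \<open>f \<in> S\<close> has degree \<open>d \<ge> 2\<close>. As \<open>d \<noteq> 0\<close> in the field, \<open>f\<close> becomes a monomial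
  \<open>c z\<^sup>d\<close> in a formal Boettcher coordinate at infinity. If some \<open>g \<in> S\<close> is not a monomial
  \<open>a z\<^sup>e\<close> in this coordinate, then \<open>f\<close> and \<open>g \<circ> f\<close> generate a free semigroup: the second exponent
  of a word tells its last letter, and composition is right cancellative. If every \<open>g \<in> S\<close> is a
  monomial, let \<open>\<rho> = a\<^bsup>d-1\<^esup> / c\<^bsup>e-1\<^esup>\<close>. If \<open>\<rho>\<close> is not a root of unity for some \<open>g\<close>, then
  \<open>f \<circ> g\<close> and \<open>g \<circ> f\<close> generate a free semigroup, because coefficients of words carry \<open>\<rho>\<close> to
  powers with distinct base \<open>d e\<close> expansions. Otherwise each degree occurs with boundedly many
  coefficients, and the degrees, being products of degrees of generators, grow polynomially.

  Suppose all elements are affine. If all slopes are roots of unity, the translation parts are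
  bounded integer combinations of finitely many numbers. If \<open>f\<close> has fixed point \<open>p\<close> and a slope \<open>a\<close>
  that is no root of unity, then either all generators fix \<open>p\<close>, and words are determined by their
  slopes, or some \<open>g\<close> with slope \<open>c\<close> does not fix \<open>p\<close>. In the latter case \<open>f\<^sup>k \<circ> g\<close> and \<open>g \<circ> f\<^sup>k\<close>
  are distinct with common slope \<open>a\<^sup>k c\<close>, so they generate a free semigroup unless \<open>a\<^sup>k c\<close> is a
  root of a polynomial with coefficients in \<open>{-1, 0, 1}\<close>; a Kronecker type argument shows that this
  cannot happen for all \<open>k\<close>.
\<close>

section \<open>Words, growth and free semigroups\<close>

lemma word_prod_Cons: "ws \<noteq> [] \<Longrightarrow> word_prod op (x # ws) = op x (word_prod op ws)"
  by (cases ws) auto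

lemma word_prod_append:
  assumes assoc: "\<And>x y z. op x (op y z) = op (op x y) z"
    and "xs \<noteq> []" "ys \<noteq> []"
  shows "word_prod op (xs @ ys) = op (word_prod op xs) (word_prod op ys)"
  using assms(2)
proof (induction xs rule: list_nonempty_induct)
  case (single x)
  then show ?case using \<open>ys \<noteq> []\<close> by (simp add: word_prod_Cons)
next
  case (cons x xs)
  then show ?case by (simp add: word_prod_Cons assoc)
qed

lemma word_prod_in_subsemigroup:
  assumes "subsemigroup op S" "ws \<noteq> []" "set ws \<subseteq> S"
  shows "word_prod op ws \<in> S"
  using assms(2,3)
proof (induction ws rule: list_nonempty_induct)
  case (cons x xs)
  then show ?case using assms(1) by (auto simp: word_prod_Cons subsemigroup_def)
qed auto

lemma subsemigroup_words:
  assumes assoc: "\<And>x y z. op x (op y z) = op (op x y) z"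
  shows "subsemigroup op (word_prod op ` nonempty_words G)"
  unfolding subsemigroup_def
proof (intro ballI, elim imageE)
  fix x y vs ws
  assume "x = word_prod op vs" "vs \<in> nonempty_words G" "y = word_prod op ws" "ws \<in> nonempty_words G"
  then show "op x y \<in> word_prod op ` nonempty_words G"
    by (intro image_eqI[of _ _ "vs @ ws"]) (auto simp: word_prod_append[OF assoc] nonempty_words_def)
qed

lemma generators_subset_words: "G \<subseteq> word_prod op ` nonempty_words G"
proof
  fix g assume "g \<in> G"
  then show "g \<in> word_prod op ` nonempty_words G"
    by (intro image_eqI[of _ _ "[g]"]) (auto simp: nonempty_words_def)
qed

lemma hull_eq_words:
  assumes assoc: "\<And>x y z. op x (op y z) = op (op x y) z"
  shows "subsemigroup op hull G = word_prod op ` nonempty_words G"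
proof (rule hull_unique)
  show "G \<subseteq> word_prod op ` nonempty_words G"
    by (rule generators_subset_words)
  show "subsemigroup op (word_prod op ` nonempty_words G)"
    by (rule subsemigroup_words[OF assoc])
  show "word_prod op ` nonempty_words G \<subseteq> t" if "G \<subseteq> t" "subsemigroup op t" for t
    using that word_prod_in_subsemigroup[of op t] by (force simp: nonempty_words_def)
qed

section \<open>Growth functions and change of generating set\<close>

lemma finite_words_le: "finite G \<Longrightarrow> finite {ws \<in> nonempty_words G. length ws \<le> n}"
  by (rule finite_subset[OF _ finite_lists_length_le[of G n]]) (auto simp: nonempty_words_def)

text \<open>Spelling each letter of \<open>H\<close> by a word of length at most \<open>L\<close> in
  \<open>G\<close> costs only the factor \<open>L\<close> in length; this compares growth for two
  generating sets.\<close>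

lemma words_refine:
  assumes assoc: "\<And>x y z. op x (op y z) = op (op x y) z"
    and len: "\<And>h. h \<in> H \<Longrightarrow> \<exists>vs\<in>nonempty_words G. length vs \<le> L \<and> word_prod op vs = h"
    and "ws \<noteq> []" "set ws \<subseteq> H"
  shows "\<exists>vs\<in>nonempty_words G. length vs \<le> L * length ws \<and> word_prod op vs = word_prod op ws"
  using assms(3,4)
proof (induction ws rule: list_nonempty_induct)
  case (single x)
  then show ?case using len[of x] by auto
next
  case (cons x xs)
  obtain us where us: "us \<in> nonempty_words G" "length us \<le> L" "word_prod op us = x"
    using len[of x] cons.prems by auto
  obtain vs where vs: "vs \<in> nonempty_words G" "length vs \<le> L * length xs"
      "word_prod op vs = word_prod op xs"
    using cons by auto
  show ?case
    by (rule bexI[of _ "us @ vs"])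
       (use us vs cons.hyps in \<open>auto simp: nonempty_words_def word_prod_append[OF assoc] word_prod_Cons\<close>)
qed

text \<open>The letters of any other finite generating set \<open>H\<close> are words in
  \<open>G\<close> of length at most some \<open>L\<close>, so
  \<open>growth op H n \<le> growth op G (L * n)\<close>. Thus \<open>L\<close> enters the constant
  but not the exponent.\<close>

lemma polynomially_bounded_growthI:
  assumes assoc: "\<And>x y z. op x (op y z) = op (op x y) z"
    and G: "finite G" "generates op G S"
    and bound: "\<And>n. growth op G n \<le> C * (n + 1) ^ k"
  shows "polynomially_bounded_growth op S"
  unfolding polynomially_bounded_growth_def
\<comment> \<open>Since \<open>\<kappa>\<close> must be positive and \<open>k\<close> may be 0, the
  exponent is \<open>k + 1\<close>.\<close>
proof (intro exI[of _ "real k + 1"] conjI allI impI; (elim conjE)?)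
  fix H assume H: "finite H" "generates op H S"
  have S: "S = word_prod op ` nonempty_words G"
    using G(2) hull_eq_words[OF assoc] by (simp add: generates_def)
  have "H \<subseteq> S"
    using H(2) by (simp add: generates_def hull_subset)
  then have "\<forall>h\<in>H. \<exists>vs\<in>nonempty_words G. word_prod op vs = h"
    unfolding S by blast
  then obtain w where w: "\<And>h. h \<in> H \<Longrightarrow> w h \<in> nonempty_words G \<and> word_prod op (w h) = h"
    by metis
  \<comment> \<open>The inserted 0 keeps \<open>Max\<close> meaningful when \<open>H\<close> is
    empty.\<close>
  define L where "L = Max (insert 0 (length ` w ` H))"
  have L: "length (w h) \<le> L" if "h \<in> H" for h
    unfolding L_def using that H(1) by (intro Max_ge) auto
  have "growth op H n \<le> growth op G (L * n)" for n
    unfolding growth_def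
  proof (intro card_mono finite_imageI finite_words_le G(1) subsetI)
    fix x assume "x \<in> word_prod op ` {ws \<in> nonempty_words H. length ws \<le> n}"
    then obtain ws where ws: "x = word_prod op ws" "ws \<in> nonempty_words H" "length ws \<le> n"
      by auto
    have "\<exists>vs\<in>nonempty_words G. length vs \<le> L * length ws \<and> word_prod op vs = word_prod op ws"
      by (rule words_refine[OF assoc, of H]) (use w L ws in \<open>auto simp: nonempty_words_def\<close>)
    moreover have "L * length ws \<le> L * n"
      using ws by simp
    ultimately show "x \<in> word_prod op ` {ws \<in> nonempty_words G. length ws \<le> L * n}"
      using ws(1) by (metis (mono_tags, lifting) image_iff le_trans mem_Collect_eq)
  qed
  then have le: "growth op H n \<le> C * (L * n + 1) ^ k" for n
    using bound[of "L * n"] le_trans by blast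
  show "(\<lambda>n. real (growth op H n)) \<in> O(\<lambda>n. real n powr (real k + 1))"
  proof (rule bigoI[of _ "real C * (real L + 1) ^ k"])
    show "\<forall>\<^sub>F n in sequentially. norm (real (growth op H n))
        \<le> real C * (real L + 1) ^ k * norm (real n powr (real k + 1))"
      using eventually_ge_at_top[of 1]
    proof eventually_elim
      case (elim n)
      have "real (growth op H n) \<le> real (C * (L * n + 1) ^ k)"
        using le[of n] of_nat_le_iff by blast
      also have "\<dots> \<le> real (C * ((L + 1) * n) ^ k)"
        using elim by (intro of_nat_mono mult_left_mono power_mono) auto
      also have "\<dots> = real C * (real L + 1) ^ k * real n powr (real k)"
        using elim by (simp add: powr_realpow distrib_right add.commute flip: power_mult_distrib)
      also have "\<dots> \<le> real C * (real L + 1) ^ k * real n powr (real k + 1)"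
        using elim by (intro mult_left_mono powr_mono) auto
      finally show ?case by simp
    qed
  qed
qed auto

text \<open>Words of length at most \<open>n\<close> are sorted by integer data \<open>m\<close>
  with values in \<open>{0..n}\<close>; there are \<open>(n + 1) ^ card I\<close> such data, and
  each accounts for at most \<open>M\<close> elements. Restricting \<open>m\<close> to
  \<open>I\<close> makes it extensional, so that the data form a finite set.\<close>

lemma growth_le_if_counted:
  assumes "finite I"
    and cover: "\<And>ws. ws \<in> nonempty_words G \<Longrightarrow>
          \<exists>m. (\<forall>i\<in>I. m i \<le> length ws) \<and> word_prod op ws \<in> B (restrict m I)"
    and B: "\<And>m. finite (B m)" "\<And>m. card (B m) \<le> M"
  shows "growth op G n \<le> M * (n + 1) ^ card I"
proof -
  let ?F = "I \<rightarrow>\<^sub>E {0..n}"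
  have fin: "finite ?F"
    using assms(1) by (intro finite_PiE) auto
  have "word_prod op ` {ws \<in> nonempty_words G. length ws \<le> n} \<subseteq> (\<Union>m\<in>?F. B m)"
  proof clarify
    fix ws assume ws: "ws \<in> nonempty_words G" "length ws \<le> n"
    obtain m where "\<forall>i\<in>I. m i \<le> length ws" "word_prod op ws \<in> B (restrict m I)"
      using cover[OF ws(1)] by auto
    then show "word_prod op ws \<in> (\<Union>m\<in>?F. B m)"
      using ws(2) by (intro UN_I[of "restrict m I"]) force+
  qed
  then have "growth op G n \<le> card (\<Union>m\<in>?F. B m)"
    unfolding growth_def using fin B(1) by (intro card_mono) auto
  also have "\<dots> \<le> (\<Sum>m\<in>?F. card (B m))"
    by (rule card_UN_le[OF fin])
  also have "\<dots> \<le> (\<Sum>m\<in>?F. M)"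
    by (intro sum_mono B)
  also have "\<dots> = M * (n + 1) ^ card I"
    using assms(1) by (simp add: card_PiE)
  finally show ?thesis .
qed

text \<open>The target is commutative, so the image of a word only sees how often each letter
  occurs. Applied below to degrees and to slopes of affine maps.\<close>

lemma hom_word_prod:
  fixes \<chi> :: "'s \<Rightarrow> 'c::comm_monoid_mult"
  assumes "finite G" and "subsemigroup op S" "G \<subseteq> S"
    and hom: "\<And>x y. x \<in> S \<Longrightarrow> y \<in> S \<Longrightarrow> \<chi> (op x y) = \<chi> x * \<chi> y"
    and "ws \<noteq> []" "set ws \<subseteq> G"
  shows "\<chi> (word_prod op ws) = (\<Prod>g\<in>G. \<chi> g ^ count_list ws g)"
proof -
  have letter: "(\<Prod>g\<in>G. \<chi> g ^ (if x = g then 1 else 0)) = \<chi> x" if "x \<in> G" for x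
  proof -
    have "(\<Prod>g\<in>G. \<chi> g ^ (if x = g then 1 else 0)) = (\<Prod>g\<in>G. if x = g then \<chi> g else 1)"
      by (rule prod.cong) auto
    then show ?thesis using that assms(1) by simp
  qed
  show ?thesis
    using assms(5,6)
  proof (induction ws rule: list_nonempty_induct)
    case (single x)
    have "(\<Prod>g\<in>G. \<chi> g ^ count_list [x] g) = (\<Prod>g\<in>G. \<chi> g ^ (if x = g then 1 else 0))"
      by (rule prod.cong) auto
    then show ?case using letter[of x] single by simp
  next
    case (cons x xs)
    have "word_prod op xs \<in> S"
      using cons assms(2,3) by (intro word_prod_in_subsemigroup) auto
    then have "\<chi> (word_prod op (x # xs)) = \<chi> x * (\<Prod>g\<in>G. \<chi> g ^ count_list xs g)"
      using cons assms(3) by (simp add: word_prod_Cons hom subset_iff)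
    also have "\<dots> = (\<Prod>g\<in>G. \<chi> g ^ ((if x = g then 1 else 0) + count_list xs g))"
      using cons.prems letter[of x] by (simp add: power_add prod.distrib)
    also have "\<dots> = (\<Prod>g\<in>G. \<chi> g ^ count_list (x # xs) g)"
      by (rule prod.cong) auto
    finally show ?case .
  qed
qed

text \<open>Words are coded as lists of booleans. Injectivity on one-letter lists already makes
  \<open>l True\<close> and \<open>l False\<close> distinct, so the alphabet has exactly two
  elements.\<close>

lemma contains_nonabelian_free_semigroupI:
  fixes l :: "bool \<Rightarrow> 's"
  assumes assoc: "\<And>x y z. op x (op y z) = op (op x y) z"
    and S: "subsemigroup op S" "\<And>b. l b \<in> S"
    and inj: "\<And>bs cs. bs \<noteq> [] \<Longrightarrow> cs \<noteq> [] \<Longrightarrow>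
        word_prod op (map l bs) = word_prod op (map l cs) \<Longrightarrow> bs = cs"
  shows "contains_nonabelian_free_semigroup op S"
proof -
  have "l True \<noteq> l False" using inj[of "[True]" "[False]"] by auto
  have range: "range l = {l True, l False}" by (auto simp: UNIV_bool)
  have words: "\<exists>bs. bs \<noteq> [] \<and> ws = map l bs" if "ws \<in> nonempty_words (range l)" for ws
    using that ex_map_conv[of ws l] by (auto simp: nonempty_words_def)
  have "inj_on (word_prod op) (nonempty_words (range l))"
  proof (rule inj_onI)
    fix vs ws assume *: "vs \<in> nonempty_words (range l)" "ws \<in> nonempty_words (range l)"
      "word_prod op vs = word_prod op ws"
    obtain bs cs where "bs \<noteq> []" "cs \<noteq> []" "vs = map l bs" "ws = map l cs"
      using words *(1,2) by metis
    then show "vs = ws" using inj[of bs cs] *(3) by auto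
  qed
  then have "free_semigroup_on op (range l) (word_prod op ` nonempty_words (range l))"
    by (simp add: free_semigroup_on_def bij_betw_def)
  moreover have "word_prod op ` nonempty_words (range l) \<subseteq> S"
    using S by (auto simp: nonempty_words_def intro!: word_prod_in_subsemigroup)
  moreover have "card (range l) = 2" using \<open>l True \<noteq> l False\<close> by (simp add: range)
  ultimately show ?thesis
    unfolding contains_nonabelian_free_semigroup_def
    using subsemigroup_words[OF assoc] by blast
qed

section \<open>Powers and roots of unity in a field\<close>

lemma power_inj_if_not_root_of_unity:
  fixes \<rho> :: "'a::field"
  assumes "\<rho> \<noteq> 0" "\<And>n. n > 0 \<Longrightarrow> \<rho> ^ n \<noteq> 1" "\<rho> ^ i = \<rho> ^ j"
  shows "i = j"
proof -
  have "\<not> i < j" if "\<rho> ^ i = \<rho> ^ j" for i j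
  proof
    assume "i < j"
    then have "\<rho> ^ j = \<rho> ^ i * \<rho> ^ (j - i)" by (simp flip: power_add)
    then show False using that assms(1) assms(2)[of "j - i"] \<open>i < j\<close> by simp
  qed
  then show ?thesis using assms(3) by (metis linorder_neqE_nat)
qed

lemma card_roots_power_eq:
  fixes b :: "'a::field"
  assumes "K > 0"
  shows "finite {z. z ^ K = b}" "card {z. z ^ K = b} \<le> K"
proof -
  let ?p = "monom 1 K - [:b:]"
  have "coeff ?p K = 1" using assms by (simp add: coeff_pCons split: nat.splits)
  then have nz: "?p \<noteq> 0" by (metis coeff_0 zero_neq_one)
  have eq: "{z. z ^ K = b} = {z. poly ?p z = 0}" by (simp add: poly_monom)
  show "finite {z. z ^ K = b}" unfolding eq using nz by (rule poly_roots_finite)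
  have "degree ?p \<le> K" by (intro degree_diff_le) (auto simp: degree_monom_le)
  then show "card {z. z ^ K = b} \<le> K"
    unfolding eq using card_poly_roots_bound[OF nz] by linarith
qed

section \<open>Roots of polynomials with coefficients in \<open>{-1, 0, 1}\<close>\<close>

abbreviation int_poly_eval :: "int poly \<Rightarrow> 'a::comm_ring_1 \<Rightarrow> 'a" where
  "int_poly_eval p x \<equiv> poly (map_poly of_int p) x"

lemma int_poly_eval_pCons: "int_poly_eval (pCons a p) x = of_int a + x * int_poly_eval p x"
  by (simp add: map_poly_pCons)

lemma int_poly_eval_add: "int_poly_eval (p + q) (x::'a::comm_ring_1) = int_poly_eval p x + int_poly_eval q x"
proof -
  have "map_poly of_int (p + q) = map_poly of_int p + (map_poly of_int q :: 'a poly)"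
    by (rule poly_eqI) (simp add: coeff_map_poly)
  then show ?thesis by simp
qed

lemma int_poly_eval_smult: "int_poly_eval (smult c p) x = of_int c * int_poly_eval p x"
  by (simp add: map_poly_smult)

lemma int_poly_eval_mult: "int_poly_eval (p * q) x = int_poly_eval p x * int_poly_eval q x"
  by (induction p)
     (simp_all add: int_poly_eval_pCons int_poly_eval_add int_poly_eval_smult mult_pCons_left algebra_simps)

text \<open>The bound \<open>n\<close> refers to the degree over the integers, because
  \<open>map_poly of_int\<close> can lower the degree in positive characteristic.\<close>

lemma int_poly_eval_eq_sum:
  fixes x :: "'a::comm_ring_1"
  assumes "degree p \<le> n"
  shows "int_poly_eval p x = (\<Sum>i\<le>n. of_int (coeff p i) * x ^ i)"
proof -
  have "degree (map_poly of_int p :: 'a poly) \<le> n"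
    using assms by (intro degree_le) (simp add: coeff_map_poly coeff_eq_0)
  then have "int_poly_eval p x = (\<Sum>i\<le>n. coeff (map_poly of_int p) i * x ^ i)"
    unfolding poly_altdef by (intro sum.mono_neutral_left) (auto simp: coeff_eq_0)
  then show ?thesis by (simp add: coeff_map_poly)
qed

text \<open>Differences of two distinct polynomials with coefficients 0 and 1 have this form. A
  coincidence between words in two affine maps of equal slope makes the slope a root of one.\<close>

definition sign_poly :: "int poly \<Rightarrow> bool" where
  "sign_poly p \<longleftrightarrow> p \<noteq> 0 \<and> (\<forall>i. coeff p i \<in> {-1, 0, 1})"

lemma sign_poly_pConsD: "sign_poly (pCons a p) \<Longrightarrow> p \<noteq> 0 \<Longrightarrow> sign_poly p"
  unfolding sign_poly_def by (metis coeff_pCons_Suc)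

lemma sign_poly_pCons_coeff: "sign_poly (pCons a p) \<Longrightarrow> a \<in> {-1, 0, 1}"
  unfolding sign_poly_def by (metis coeff_pCons_0)

text \<open>In a Horner step the factor \<open>z\<close> at least doubles a quantity of norm at
  least 1, and the new coefficient removes at most 1. Hence all complex roots have modulus less than
  2.\<close>

lemma norm_sign_poly_ge_1:
  fixes z :: complex
  assumes "sign_poly p" "norm z \<ge> 2"
  shows "norm (int_poly_eval p z) \<ge> 1"
  using assms(1)
proof (induction p)
  case 0
  then show ?case by (simp add: sign_poly_def)
next
  case (pCons a p)
  have a: "a \<in> {-1, 0, 1}" using pCons.prems by (rule sign_poly_pCons_coeff)
  show ?case
  proof (cases "p = 0")
    case True
    then show ?thesis using pCons.hyps a by (auto simp: int_poly_eval_pCons)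
  next
    case False
    then have "norm (int_poly_eval p z) \<ge> 1"
      using pCons.IH sign_poly_pConsD[OF pCons.prems] by blast
    then have "2 * 1 \<le> norm z * norm (int_poly_eval p z)"
      using assms(2) by (intro mult_mono) auto
    then have "2 \<le> norm (z * int_poly_eval p z)"
      by (simp add: norm_mult)
    moreover have "norm (complex_of_int a) \<le> 1" using a by auto
    moreover have "norm (z * int_poly_eval p z) \<le>
        norm (of_int a + z * int_poly_eval p z) + norm (complex_of_int a)"
      by (metis add_diff_cancel_left' norm_triangle_ineq4)
    ultimately show ?thesis by (simp add: int_poly_eval_pCons)
  qed
qed

text \<open>As \<open>x\<close> is nonzero, vanishing low coefficients can be stripped off by
  dividing by \<open>x\<close>.\<close>

lemma sign_poly_nonzero_constant:
  fixes x :: "'a::field"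
  assumes "sign_poly p" "int_poly_eval p x = 0" "x \<noteq> 0"
  shows "\<exists>q. sign_poly q \<and> int_poly_eval q x = 0 \<and> coeff q 0 \<noteq> 0"
  using assms(1,2)
proof (induction p)
  case (pCons a p)
  show ?case
  proof (cases "a = 0")
    case True
    then have "p \<noteq> 0" using pCons.hyps by auto
    then show ?thesis
      using pCons True sign_poly_pConsD assms(3) by (auto simp: int_poly_eval_pCons)
  next
    case False
    then show ?thesis using pCons by (intro exI[of _ "pCons a p"]) auto
  qed
qed (simp add: sign_poly_def)

section \<open>Integer linear relations and finitely generated additive groups\<close>

lemma integer_kernel:
  fixes t :: "'i \<Rightarrow> 'j \<Rightarrow> int"
  assumes "finite J" "finite I" "card I > card J"
  shows "\<exists>c. (\<exists>i\<in>I. c i \<noteq> 0) \<and> (\<forall>j\<in>J. (\<Sum>i\<in>I. c i * t i j) = 0)"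
  using assms
proof (induction J arbitrary: I t rule: finite_induct)
  case empty
  then have "I \<noteq> {}" by auto
  then show ?case by (intro exI[of _ "\<lambda>_. 1"]) auto
next
  case (insert k J)
  show ?case
  proof (cases "\<exists>p\<in>I. t p k \<noteq> 0")
    case False
    obtain c where "\<exists>i\<in>I. c i \<noteq> 0" "\<forall>j\<in>J. (\<Sum>i\<in>I. c i * t i j) = 0"
      using insert.IH[of I t] insert.prems insert.hyps card_insert_disjoint by (metis Suc_lessD)
    moreover have "(\<Sum>i\<in>I. c i * t i k) = 0"
      using False by (intro sum.neutral) auto
    ultimately show ?thesis by blast
  next
    case True
    then obtain p where p: "p \<in> I" "t p k \<noteq> 0" by blast
    define I' where "I' = I - {p}"
    have I': "finite I'" "card I' > card J" "p \<notin> I'" "I = insert p I'"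
      using insert.prems insert.hyps p by (auto simp: I'_def card_Diff_singleton)
    \<comment> \<open>Fraction-free elimination of the unknown \<open>p\<close> by means of equation
      \<open>k\<close>; the modified coefficients vanish at \<open>j = k\<close>.\<close>
    obtain c where c: "\<exists>i\<in>I'. c i \<noteq> 0"
        "\<forall>j\<in>J. (\<Sum>i\<in>I'. c i * (t p k * t i j - t i k * t p j)) = 0"
      using insert.IH[of I' "\<lambda>i j. t p k * t i j - t i k * t p j"] I' by blast
    \<comment> \<open>Scaling the other unknowns by the pivot \<open>t p k\<close> lets equation
      \<open>k\<close> be solved for the unknown \<open>p\<close> over the integers.\<close>
    define c' where "c' i = (if i = p then - (\<Sum>i\<in>I'. c i * t i k) else c i * t p k)" for i
    have sum: "(\<Sum>i\<in>I. c' i * t i j) = (\<Sum>i\<in>I'. c i * (t p k * t i j - t i k * t p j))" for j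
    proof -
      have "(\<Sum>i\<in>I'. c' i * t i j) = (\<Sum>i\<in>I'. c i * t p k * t i j)"
        using I'(3) by (intro sum.cong) (auto simp: c'_def)
      then have "(\<Sum>i\<in>I. c' i * t i j) = (\<Sum>i\<in>I'. c i * t p k * t i j) - (\<Sum>i\<in>I'. c i * t i k) * t p j"
        using I' by (simp add: c'_def)
      then show ?thesis
        by (simp add: sum_subtractf sum_distrib_right right_diff_distrib mult.assoc)
    qed
    have "\<exists>i\<in>I. c' i \<noteq> 0"
      using c(1) p(2) I'(3,4) by (auto simp: c'_def)
    moreover have "(\<Sum>i\<in>I. c' i * t i j) = 0" if "j \<in> insert k J" for j
      using that c(2) unfolding sum by (auto simp: mult.commute)
    ultimately show ?thesis by blast
  qed
qed

definition int_span :: "('i \<Rightarrow> 'a) \<Rightarrow> 'i set \<Rightarrow> 'a::comm_ring_1 set" where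
  "int_span e I = range (\<lambda>t. \<Sum>i\<in>I. of_int (t i) * e i)"

lemma int_spanI: "x = (\<Sum>i\<in>I. of_int (t i) * e i) \<Longrightarrow> x \<in> int_span e I"
  by (auto simp: int_span_def)

lemma int_span_0: "0 \<in> int_span e I"
  unfolding int_span_def by (rule range_eqI[of _ _ "\<lambda>_. 0"]) simp

lemma int_span_add: "x \<in> int_span e I \<Longrightarrow> y \<in> int_span e I \<Longrightarrow> x + y \<in> int_span e I"
proof -
  assume "x \<in> int_span e I" "y \<in> int_span e I"
  then obtain s t where "x = (\<Sum>i\<in>I. of_int (s i) * e i)" "y = (\<Sum>i\<in>I. of_int (t i) * e i)"
    by (auto simp: int_span_def)
  then have "x + y = (\<Sum>i\<in>I. of_int (s i + t i) * e i)"
    by (simp add: sum.distrib algebra_simps)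
  then show ?thesis by (rule int_spanI)
qed

lemma int_span_scale: "x \<in> int_span e I \<Longrightarrow> of_int c * x \<in> int_span e I"
proof -
  assume "x \<in> int_span e I"
  then obtain s where "x = (\<Sum>i\<in>I. of_int (s i) * e i)"
    by (auto simp: int_span_def)
  then have "of_int c * x = (\<Sum>i\<in>I. of_int (c * s i) * e i)"
    by (simp add: sum_distrib_left mult.assoc)
  then show ?thesis by (rule int_spanI)
qed

lemma int_span_sum: "(\<And>k. k \<in> A \<Longrightarrow> f k \<in> int_span e I) \<Longrightarrow> sum f A \<in> int_span e I"
  by (induction A rule: infinite_finite_induct) (auto intro: int_span_0 int_span_add)

lemma int_span_base:
  assumes "finite I" "i \<in> I"
  shows "e i \<in> int_span e I"
proof -
  have "(\<Sum>j\<in>I. of_int (if j = i then 1 else 0) * e j) = (\<Sum>j\<in>I. if j = i then e j else 0)"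
    by (rule sum.cong) auto
  also have "\<dots> = e i" using assms by simp
  finally show ?thesis
    by (intro int_spanI[where t = "\<lambda>j. if j = i then 1 else 0"]) (rule sym)
qed

lemma int_span_mult_closed:
  assumes "\<And>i. i \<in> I \<Longrightarrow> x * e i \<in> int_span e I" "y \<in> int_span e I"
  shows "x * y \<in> int_span e I"
proof -
  obtain s where "y = (\<Sum>i\<in>I. of_int (s i) * e i)"
    using assms(2) by (auto simp: int_span_def)
  then have "x * y = (\<Sum>i\<in>I. of_int (s i) * (x * e i))"
    by (simp add: sum_distrib_left mult_ac)
  then show ?thesis
    using assms(1) by (auto intro!: int_span_sum int_span_scale)
qed

lemma int_poly_eval_mult_closed:
  assumes "\<And>y. y \<in> int_span e I \<Longrightarrow> x * y \<in> int_span e I" "y \<in> int_span e I"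
  shows "int_poly_eval p x * y \<in> int_span e I"
proof (induction p)
  case (pCons a p)
  then have "of_int a * y + x * (int_poly_eval p x * y) \<in> int_span e I"
    using assms by (intro int_span_add int_span_scale) auto
  then show ?case by (simp add: int_poly_eval_pCons algebra_simps)
qed (simp add: int_span_0)

text \<open>Coefficients matter only modulo the characteristic, so finitely many coefficient vectors
  suffice.\<close>

lemma finite_int_span:
  assumes "finite I" "CHAR('a::comm_ring_1) > 0"
  shows "finite (int_span (e :: 'i \<Rightarrow> 'a) I)"
proof -
  let ?c = "int CHAR('a)"
  have mod: "of_int (k mod ?c) = (of_int k :: 'a)" for k
  proof -
    have "of_int (?c * (k div ?c) + k mod ?c) = (of_int (k mod ?c) :: 'a)"
      unfolding of_int_add of_int_mult by simp
    then show ?thesis by simp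
  qed
  have "int_span e I \<subseteq> (\<lambda>t. \<Sum>i\<in>I. of_int (t i) * e i) ` (I \<rightarrow>\<^sub>E {0..<?c})"
  proof
    fix x assume "x \<in> int_span e I"
    then obtain t where t: "x = (\<Sum>i\<in>I. of_int (t i) * e i)" by (auto simp: int_span_def)
    show "x \<in> (\<lambda>t. \<Sum>i\<in>I. of_int (t i) * e i) ` (I \<rightarrow>\<^sub>E {0..<?c})"
      by (rule image_eqI[of _ _ "restrict (\<lambda>i. t i mod ?c) I"]) (use assms in \<open>auto simp: t mod\<close>)
  qed
  then show ?thesis
    by (rule finite_subset) (use assms(1) in \<open>auto intro: finite_PiE\<close>)
qed

text \<open>The powers up to \<open>x ^ card I\<close> are one more in number than the generators,
  so their integer coordinate vectors are dependent over the integers. The degree bound depends only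
  on \<open>I\<close> and is thus uniform in \<open>x\<close>.\<close>

lemma int_span_algebraic:
  fixes x :: "'a::comm_ring_1"
  assumes "finite I" "\<And>k. x ^ k \<in> int_span e I"
  shows "\<exists>p. p \<noteq> 0 \<and> degree p \<le> card I \<and> int_poly_eval p x = 0"
proof -
  have "\<forall>k. \<exists>t. x ^ k = (\<Sum>i\<in>I. of_int (t i) * e i)"
    using assms(2) by (auto simp: int_span_def)
  then obtain t where t: "\<And>k. x ^ k = (\<Sum>i\<in>I. of_int (t k i) * e i)"
    by metis
  obtain c where c: "\<exists>k\<in>{..card I}. c k \<noteq> 0" "\<forall>i\<in>I. (\<Sum>k\<le>card I. c k * t k i) = 0"
    using integer_kernel[of I "{..card I}" t] assms(1) by auto
  define p where "p = (\<Sum>k\<le>card I. monom (c k) k)"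
  have coeff: "coeff p j = (if j \<le> card I then c j else 0)" for j
    by (simp add: p_def coeff_sum)
  have "p \<noteq> 0"
    using c(1) coeff by (metis atMost_iff coeff_0)
  moreover have deg: "degree p \<le> card I"
    by (rule degree_le) (simp add: coeff)
  moreover have "int_poly_eval p x = 0"
  proof -
    have "int_poly_eval p x = (\<Sum>k\<le>card I. of_int (c k) * x ^ k)"
      by (simp add: int_poly_eval_eq_sum[OF deg] coeff)
    also have "\<dots> = (\<Sum>k\<le>card I. \<Sum>i\<in>I. of_int (c k * t k i) * e i)"
      by (simp add: t sum_distrib_left mult.assoc)
    also have "\<dots> = (\<Sum>i\<in>I. of_int (\<Sum>k\<le>card I. c k * t k i) * e i)"
      by (subst sum.swap) (simp add: sum_distrib_right)
    also have "\<dots> = 0" using c(2) by simp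
    finally show ?thesis .
  qed
  ultimately show ?thesis by blast
qed

section \<open>Integer factors of sign polynomials\<close>

lemma primitive_dvd_smultD:
  fixes p q :: "int poly"
  assumes "content q = 1" "a \<noteq> 0" "q dvd smult a p"
  shows "q dvd p"
proof -
  obtain s where s: "smult a p = q * s" using assms(3) by (auto elim: dvdE)
  \<comment> \<open>By multiplicativity of the content (Gauss's lemma), \<open>a\<close> must divide
    the cofactor \<open>s\<close>.\<close>
  have "content s = normalize a * content p"
    using arg_cong[OF s, of content] assms(1) by (simp add: content_mult content_smult)
  then have "a dvd content s" by simp
  then have "[:a:] dvd s" by (simp add: const_poly_dvd_iff_dvd_content)
  then obtain s' where "s = smult a s'" by (auto elim!: dvdE)
  then have "smult a p = smult a (q * s')" using s by simp
  then show ?thesis using assms(2) by (metis dvd_triv_left smult_cancel)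
qed

text \<open>Each linear factor multiplies the coefficient bound by at most
  \<open>2 + 1\<close>.\<close>

lemma norm_coeff_prod_le:
  fixes r :: "nat \<Rightarrow> complex"
  assumes "\<And>i. i < n \<Longrightarrow> norm (r i) \<le> 2"
  shows "norm (coeff (\<Prod>i<n. [:- r i, 1:]) k) \<le> 3 ^ n"
  using assms
proof (induction n arbitrary: k)
  case 0
  then show ?case by (simp add: coeff_1)
next
  case (Suc n)
  let ?p = "\<Prod>i<n. [:- r i, 1:]"
  have IH: "norm (coeff ?p k) \<le> 3 ^ n" for k
    using Suc by simp
  have "coeff (\<Prod>i<Suc n. [:- r i, 1:]) k = - r n * coeff ?p k + coeff (pCons 0 ?p) k"
    by (simp add: mult.commute[of ?p])
  moreover have "norm (- r n * coeff ?p k) \<le> 2 * 3 ^ n"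
    unfolding norm_mult using Suc.prems[of n] IH by (intro mult_mono) auto
  moreover have "norm (coeff (pCons 0 ?p) k) \<le> 3 ^ n"
    using IH by (cases k) auto
  ultimately show ?case
    using norm_triangle_ineq[of "- r n * coeff ?p k" "coeff (pCons 0 ?p) k"] by simp
qed

text \<open>The leading coefficient of \<open>q\<close> divides that of \<open>p\<close>, which is 1
  or -1, and the complex roots of \<open>q\<close> are roots of \<open>p\<close>, hence of modulus
  below 2. Expanding the product of linear factors bounds the coefficients by the degree of
  \<open>q\<close> alone.\<close>

lemma sign_poly_factor_coeff_bound:
  assumes "sign_poly p" "q dvd p"
  shows "\<bar>coeff q k\<bar> \<le> 3 ^ degree q"
proof -
  obtain s where s: "p = q * s" using assms(2) by (auto elim: dvdE)
  have p0: "p \<noteq> 0" using assms(1) by (simp add: sign_poly_def)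
  have "lead_coeff p \<in> {-1, 0, 1}" "lead_coeff p \<noteq> 0"
    using assms(1) by (auto simp: sign_poly_def)
  then have "\<bar>lead_coeff p\<bar> = 1" by auto
  then have lc: "\<bar>lead_coeff q\<bar> = 1"
    unfolding s lead_coeff_mult by (rule abs_zmult_eq_1)
  let ?q = "map_poly of_int q :: complex poly"
  have deg: "degree ?q = degree q" by (rule degree_map_poly) auto
  obtain r where r: "smult (lead_coeff ?q) (\<Prod>i<degree ?q. [:- r i, 1:]) = ?q"
    by (rule complex_poly_decompose')
  have small: "norm (r i) \<le> 2" if "i < degree q" for i
  proof (rule ccontr)
    assume "\<not> norm (r i) \<le> 2"
    then have "norm (int_poly_eval p (r i)) \<ge> 1"
      using norm_sign_poly_ge_1[OF assms(1)] by auto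
    moreover have "int_poly_eval q (r i) = 0"
      using that deg by (subst r[symmetric]) (auto simp: poly_prod)
    ultimately show False by (simp add: s int_poly_eval_mult)
  qed
  have "real_of_int \<bar>coeff q k\<bar> = norm (coeff ?q k)"
    by (simp add: coeff_map_poly)
  also have "\<dots> = norm (lead_coeff ?q) * norm (coeff (\<Prod>i<degree q. [:- r i, 1:]) k)"
    by (subst r[symmetric]) (simp add: norm_mult deg)
  also have "norm (lead_coeff ?q) = 1"
    using lc by (simp add: deg coeff_map_poly flip: of_int_abs)
  also have "1 * norm (coeff (\<Prod>i<degree q. [:- r i, 1:]) k) \<le> 3 ^ degree q"
    using norm_coeff_prod_le[of "degree q" r k] small by simp
  finally have "real_of_int \<bar>coeff q k\<bar> \<le> real_of_int (3 ^ degree q)" by simp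
  then show ?thesis by (simp only: of_int_le_iff)
qed

lemma finite_bounded_int_polys: "finite {q :: int poly. degree q \<le> m \<and> (\<forall>k. \<bar>coeff q k\<bar> \<le> b)}"
proof (rule finite_subset)
  show "{q. degree q \<le> m \<and> (\<forall>k. \<bar>coeff q k\<bar> \<le> b)} \<subseteq> Poly ` {xs. set xs \<subseteq> {-b..b} \<and> length xs \<le> Suc m}"
  proof clarify
    fix q assume q: "degree q \<le> m" "\<forall>k. \<bar>coeff q k\<bar> \<le> b"
    then have "set (coeffs q) \<subseteq> {-b..b}" "length (coeffs q) \<le> Suc m"
      by (auto simp: coeffs_def abs_le_iff minus_le_iff)
    then show "q \<in> Poly ` {xs. set xs \<subseteq> {-b..b} \<and> length xs \<le> Suc m}"
      by (intro image_eqI[of _ _ "coeffs q"]) auto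
  qed
  show "finite (Poly ` {xs. set xs \<subseteq> {-b..b} \<and> length xs \<le> Suc m})"
    by (intro finite_imageI finite_lists_length_le) auto
qed

text \<open>Characteristic zero lets the content be cancelled, so a nonzero integer polynomial of
  least degree vanishing at \<open>x\<close> can be taken primitive. It divides \<open>p\<close> by
  Gauss's lemma and inherits the bound for factors of sign polynomials, while \<open>r\<close>
  bounds its degree. For fixed \<open>m\<close> only finitely many \<open>q\<close> arise.\<close>

lemma sign_poly_root_small_poly:
  fixes x :: "'a::field"
  assumes char: "CHAR('a) = 0" and p: "sign_poly p" "int_poly_eval p x = 0"
    and r: "r \<noteq> 0" "degree r \<le> m" "int_poly_eval r x = 0"
  shows "\<exists>q. q \<noteq> 0 \<and> degree q \<le> m \<and> (\<forall>k. \<bar>coeff q k\<bar> \<le> 3 ^ m) \<and> int_poly_eval q x = 0"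
proof -
  have of_int0: "of_int k = (0::'a) \<longleftrightarrow> k = 0" for k
    using char by (simp add: of_int_eq_0_iff_char_dvd)
  let ?R = "\<lambda>q. q \<noteq> 0 \<and> int_poly_eval q x = 0"
  obtain q0 where q0: "?R q0" "\<And>q. ?R q \<Longrightarrow> degree q0 \<le> degree q"
    using ex_has_least_nat[of ?R r degree] r by blast
  define q where "q = primitive_part q0"
  have q0_eq: "q0 = smult (content q0) q"
    by (simp add: q_def content_times_primitive_part)
  then have "of_int (content q0) * int_poly_eval q x = 0"
    using q0(1) by (metis int_poly_eval_smult)
  then have q: "?R q" "content q = 1" "degree q = degree q0"
    using q0(1) of_int0 by (auto simp: q_def)
  \<comment> \<open>The pseudo-remainder vanishes at \<open>x\<close>; if nonzero, it would have
    smaller degree than \<open>q\<close>, against minimality.\<close>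
  obtain a s where as: "a \<noteq> 0" "smult a p = q * s + pseudo_mod p q"
    using pseudo_mod(1)[of q p] q(1) by blast
  have "int_poly_eval (pseudo_mod p q) x = int_poly_eval (smult a p) x - int_poly_eval (q * s) x"
    by (simp add: as(2) int_poly_eval_add)
  also have "\<dots> = 0"
    using p(2) q(1) by (simp add: int_poly_eval_smult int_poly_eval_mult)
  finally have "pseudo_mod p q = 0"
    using degree_pseudo_mod_less[of q p] q q0(2)[of "pseudo_mod p q"] by force
  then have "q dvd smult a p" using as(2) by simp
  then have "q dvd p" using primitive_dvd_smultD q(2) as(1) by blast
  then have "\<bar>coeff q k\<bar> \<le> 3 ^ degree q" for k
    by (rule sign_poly_factor_coeff_bound[OF p(1)])
  moreover have deg: "degree q \<le> m"
    using q0(2)[of r] r q(3) by auto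
  moreover have "(3::int) ^ degree q \<le> 3 ^ m"
    using deg by (intro power_increasing) auto
  ultimately show ?thesis
    using q(1) by (intro exI[of _ q]) (meson order_trans)
qed


text \<open>The constant term \<open>a\<close> satisfies \<open>a * a = 1\<close>, so solving the
  equation for \<open>a\<close> exhibits an inverse of \<open>x\<close> in the ring generated by
  \<open>x\<close>.\<close>

lemma sign_poly_root_inverse:
  fixes x :: "'a::field"
  assumes "sign_poly p" "int_poly_eval p x = 0" "coeff p 0 \<noteq> 0"
  shows "\<exists>q. inverse x = int_poly_eval q x"
proof -
  obtain a q where p: "p = pCons a q" by (cases p) auto
  have "a = 1 \<or> a = -1"
    using assms(1,3) sign_poly_pCons_coeff[of a q] unfolding p by auto
  then have "x * int_poly_eval (smult (-a) q) x = 1"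
    using assms(2) unfolding p int_poly_eval_pCons int_poly_eval_smult
    by (auto simp: add_eq_0_iff)
  then show ?thesis by (metis inverse_unique)
qed

text \<open>The leading coefficient is 1 or -1, so \<open>x\<close> is integral and its top power
  can be rewritten through lower ones.\<close>

lemma sign_poly_root_power_reduce:
  fixes x :: "'a::field"
  assumes "sign_poly p" "int_poly_eval p x = 0"
  shows "\<exists>c. x ^ degree p = (\<Sum>i<degree p. of_int (c i) * x ^ i)"
proof -
  let ?n = "degree p"
  have "coeff p ?n = 1 \<or> coeff p ?n = -1"
    using assms(1) unfolding sign_poly_def by (metis insert_iff leading_coeff_0_iff singletonD)
  moreover have "(\<Sum>i<?n. of_int (coeff p i) * x ^ i) + of_int (coeff p ?n) * x ^ ?n = 0"
    using assms(2) int_poly_eval_eq_sum[of p ?n x] by (simp add: lessThan_Suc_atMost[symmetric])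
  ultimately have "x ^ ?n = (\<Sum>i<?n. of_int (- coeff p ?n * coeff p i) * x ^ i)"
    by (auto simp: sum_negf add_eq_0_iff2)
  then show ?thesis by (intro exI[of _ "\<lambda>i. - coeff p ?n * coeff p i"])
qed

text \<open>
  All the numbers \<open>a ^ k * c\<close> lie in a ring that is finitely generated as an abelian group, so in
  characteristic zero they are roots of integer polynomials of bounded degree, and being roots of
  sign polynomials makes these polynomials range over a finite set.
\<close>

lemma root_of_unity_if_sign_poly_roots:
  fixes a c :: "'a::field"
  assumes "a \<noteq> 0" "c \<noteq> 0"
    and roots: "\<And>k. k \<ge> 1 \<Longrightarrow> \<exists>p. sign_poly p \<and> int_poly_eval p (a ^ k * c) = 0"
  shows "\<exists>n>0. a ^ n = 1"
proof -
  \<comment> \<open>Only exponents \<open>k \<ge> 1\<close> are covered by \<open>roots\<close>; the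
    values for 1 and 2 suffice because \<open>a = y * inverse x\<close>.\<close>
  define x y where "x = a * c" and "y = a\<^sup>2 * c"
  have nz: "x \<noteq> 0" "y \<noteq> 0" using assms by (auto simp: x_def y_def)
  obtain p where p: "sign_poly p" "int_poly_eval p x = 0" "coeff p 0 \<noteq> 0"
    using roots[of 1] nz(1) sign_poly_nonzero_constant[of _ x] by (auto simp: x_def)
  obtain q where q: "sign_poly q" "int_poly_eval q y = 0"
    using roots[of 2] by (auto simp: y_def)
  have "degree p \<noteq> 0" "degree q \<noteq> 0"
  proof -
    have "degree r \<noteq> 0" if r: "sign_poly r" "int_poly_eval r z = 0" for r and z :: 'a
    proof
      assume "degree r = 0"
      then obtain b where "r = [:b:]" by (auto elim: degree_eq_zeroE)
      moreover from this have "b \<in> {-1, 1}"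
        using r(1) sign_poly_pCons_coeff[of b 0] by (auto simp: sign_poly_def)
      ultimately show False using r(2) by (auto simp: int_poly_eval_pCons)
    qed
    then show "degree p \<noteq> 0" "degree q \<noteq> 0" using p q by blast+
  qed
  \<comment> \<open>By integrality of \<open>x\<close> and \<open>y\<close>, these monomials
    generate the ring of integer polynomials in \<open>x\<close> and \<open>y\<close> as an additive
    group.\<close>
  define I where "I = {..<degree p} \<times> {..<degree q}"
  define e where "e = (\<lambda>(i, j). x ^ i * y ^ j)"
  have [simp]: "finite I" by (simp add: I_def)
  let ?M = "int_span e I"
  have e: "x ^ i * y ^ j \<in> ?M" if "i < degree p" "j < degree q" for i j
    using int_span_base[of I "(i, j)" e] that by (simp add: I_def e_def)
  have one: "1 \<in> ?M"
    using e[of 0 0] \<open>degree p \<noteq> 0\<close> \<open>degree q \<noteq> 0\<close> by simp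
  have x_closed: "x * z \<in> ?M" if "z \<in> ?M" for z
  proof (rule int_span_mult_closed[OF _ that])
    fix ij assume "ij \<in> I"
    then obtain i j where ij: "ij = (i, j)" "i < degree p" "j < degree q" by (auto simp: I_def)
    show "x * e ij \<in> ?M"
    proof (cases "Suc i < degree p")
      case True
      then show ?thesis using e[of "Suc i" j] ij by (simp add: e_def mult.assoc)
    next
      case False
      then have "degree p = Suc i" using ij by simp
      obtain b where "x ^ degree p = (\<Sum>i<degree p. of_int (b i) * x ^ i)"
        using sign_poly_root_power_reduce[OF p(1,2)] by blast
      then have "x * e ij = (\<Sum>i<degree p. of_int (b i) * x ^ i) * y ^ j"
        using \<open>degree p = Suc i\<close> ij by (simp add: e_def mult.assoc[symmetric])
      also have "\<dots> = (\<Sum>i<degree p. of_int (b i) * (x ^ i * y ^ j))"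
        by (simp add: sum_distrib_right mult.assoc)
      also have "\<dots> \<in> ?M" using ij by (auto intro!: int_span_sum int_span_scale e)
      finally show ?thesis .
    qed
  qed
  have y_closed: "y * z \<in> ?M" if "z \<in> ?M" for z
  proof (rule int_span_mult_closed[OF _ that])
    fix ij assume "ij \<in> I"
    then obtain i j where ij: "ij = (i, j)" "i < degree p" "j < degree q" by (auto simp: I_def)
    show "y * e ij \<in> ?M"
    proof (cases "Suc j < degree q")
      case True
      then show ?thesis using e[of i "Suc j"] ij by (simp add: e_def mult.left_commute)
    next
      case False
      then have "degree q = Suc j" using ij by simp
      obtain b where "y ^ degree q = (\<Sum>i<degree q. of_int (b i) * y ^ i)"
        using sign_poly_root_power_reduce[OF q] by blast
      then have "y * e ij = (\<Sum>j<degree q. of_int (b j) * y ^ j) * x ^ i"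
        using \<open>degree q = Suc j\<close> ij by (simp add: e_def mult_ac)
      also have "\<dots> = (\<Sum>j<degree q. of_int (b j) * (x ^ i * y ^ j))"
        by (simp add: sum_distrib_left mult_ac)
      also have "\<dots> \<in> ?M" using ij by (auto intro!: int_span_sum int_span_scale e)
      finally show ?thesis .
    qed
  qed
  obtain r where r: "inverse x = int_poly_eval r x"
    using sign_poly_root_inverse[OF p] by blast
  \<comment> \<open>As \<open>inverse x\<close> is an integer polynomial in \<open>x\<close>,
    multiplication by \<open>a\<close> preserves \<open>?M\<close> too.\<close>
  have "a = y * inverse x"
    using assms(1,2) by (simp add: x_def y_def power2_eq_square field_simps)
  then have a_closed: "a * z \<in> ?M" if "z \<in> ?M" for z
    using that int_poly_eval_mult_closed[OF x_closed that, of r] y_closed r by (simp add: mult.assoc)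
  have pow_closed: "a ^ k * z \<in> ?M" if "z \<in> ?M" for k z
    using that by (induction k) (auto simp: mult.assoc intro: a_closed)
  have closed: "a ^ k * c * z \<in> ?M" if "k \<ge> 1" "z \<in> ?M" for k z
  proof -
    have "a ^ k * c * z = a ^ (k - 1) * (x * z)"
      using that(1) by (cases k) (auto simp: x_def mult_ac)
    then show ?thesis using pow_closed[OF x_closed[OF that(2)], of "k - 1"] by (simp only:)
  qed
  have pow_in: "(a ^ k * c) ^ n \<in> ?M" if "k \<ge> 1" for k n
    by (induction n) (use that one closed in auto)
  \<comment> \<open>In positive characteristic \<open>?M\<close> itself is finite. In characteristic
    zero all values are roots of nonzero integer polynomials with bounded degree and coefficients,
    and there are finitely many of those.\<close>
  have "finite ((\<lambda>k. a ^ k * c) ` {1..})"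
  proof (cases "CHAR('a) = 0")
    case False
    have "(\<lambda>k. a ^ k * c) ` {1..} \<subseteq> ?M"
      using pow_in[of _ 1] by auto
    then show ?thesis
      using finite_subset finite_int_span[of I e] False by auto
  next
    case True
    have of_int0: "of_int k = (0::'a) \<longleftrightarrow> k = 0" for k
      using True by (simp add: of_int_eq_0_iff_char_dvd)
    let ?Q = "{q :: int poly. degree q \<le> card I \<and> (\<forall>k. \<bar>coeff q k\<bar> \<le> 3 ^ card I)} - {0}"
    have "(\<lambda>k. a ^ k * c) ` {1..} \<subseteq> (\<Union>q\<in>?Q. {z. int_poly_eval q z = 0})"
    proof clarify
      fix k :: nat assume k: "k \<ge> 1"
      obtain r where "sign_poly r" "int_poly_eval r (a ^ k * c) = 0" using roots k by blast
      moreover obtain s where "s \<noteq> 0" "degree s \<le> card I" "int_poly_eval s (a ^ k * c) = 0"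
        using int_span_algebraic[of I "a ^ k * c" e] pow_in[OF k] by auto
      ultimately obtain q where "q \<noteq> 0" "degree q \<le> card I" "\<forall>k. \<bar>coeff q k\<bar> \<le> 3 ^ card I"
          "int_poly_eval q (a ^ k * c) = 0"
        using sign_poly_root_small_poly[OF True] by blast
      then show "a ^ k * c \<in> (\<Union>q\<in>?Q. {z. int_poly_eval q z = 0})" by blast
    qed
    moreover have "finite (\<Union>q\<in>?Q. {z::'a. int_poly_eval q z = 0})"
    proof (rule finite_UN_I)
      show "finite ?Q" using finite_bounded_int_polys by blast
      fix q assume "q \<in> ?Q"
      \<comment> \<open>Characteristic zero keeps the leading coefficient nonzero in the field, so
        \<open>q\<close> has finitely many roots there.\<close>
      then have "coeff (map_poly of_int q :: 'a poly) (degree q) \<noteq> 0"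
        using of_int0 by (simp add: coeff_map_poly)
      then show "finite {z::'a. int_poly_eval q z = 0}"
        by (intro poly_roots_finite) auto
    qed
    ultimately show ?thesis by (rule finite_subset)
  qed
  \<comment> \<open>Pigeonhole: infinitely many exponents, finitely many values.\<close>
  then have "\<not> inj_on (\<lambda>k. a ^ k * c) {1..}"
    using finite_imageD infinite_Ici by blast
  then obtain i j where "i \<noteq> j" "a ^ i = a ^ j"
    using assms(2) by (auto simp: inj_on_def)
  then show ?thesis using power_inj_if_not_root_of_unity[OF assms(1)] by blast
qed

section \<open>Boettcher coordinates at infinity\<close>

text \<open>The expansion of \<open>g\<close> at infinity, \<open>1 / g (1 / z)\<close>.\<close>

definition at_inf :: "'a::field poly \<Rightarrow> 'a fps" where
  "at_inf g = fps_X ^ degree g * inverse (fps_of_poly (reflect_poly g))"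

lemma at_inf_nth_0: "degree g > 0 \<Longrightarrow> at_inf g $ 0 = 0"
  by (simp add: at_inf_def)

text \<open>The reflected polynomial has the leading coefficient of \<open>g\<close> as constant
  term and is a unit, so only the power of \<open>fps_X\<close> counts.\<close>

lemma subdegree_at_inf: "g \<noteq> 0 \<Longrightarrow> subdegree (at_inf g) = degree g"
  unfolding at_inf_def by (subst subdegree_mult) (auto simp: fps_X_power_subdegree)

text \<open>Reflection forgets factors of the variable, but the subdegree recovers the degree, which
  fixes the position of each coefficient.\<close>

lemma inj_on_at_inf: "inj_on at_inf {g :: 'a::field poly. g \<noteq> 0}"
proof (rule inj_onI)
  fix f g :: "'a poly"
  assume fg: "f \<in> {g. g \<noteq> 0}" "g \<in> {g. g \<noteq> 0}" "at_inf f = at_inf g"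
  then have deg: "degree f = degree g"
    using subdegree_at_inf[of f] subdegree_at_inf[of g] by simp
  let ?f = "fps_of_poly (reflect_poly f)" and ?g = "fps_of_poly (reflect_poly g)"
  have "fps_X ^ degree g * inverse ?f = fps_X ^ degree g * inverse ?g"
    using fg(3) unfolding at_inf_def deg .
  then have "inverse (inverse ?f) = inverse (inverse ?g)" by simp
  moreover have "inverse (inverse ?f) = ?f" "inverse (inverse ?g) = ?g"
    using fg(1,2) by (auto intro!: fps_inverse_idempotent)
  ultimately have "?f = ?g" by (simp only:)
  then have refl: "reflect_poly f = reflect_poly g"
    by (simp add: fps_of_poly_eq_iff)
  show "f = g"
  proof (rule poly_eqI)
    fix i
    show "coeff f i = coeff g i"
    proof (cases "i \<le> degree f")
      case True
      then have "coeff (reflect_poly f) (degree f - i) = coeff f i"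
        by (simp add: coeff_reflect_poly)
      moreover have "coeff (reflect_poly g) (degree g - i) = coeff g i"
        using True deg by (simp add: coeff_reflect_poly)
      ultimately show ?thesis using refl deg by simp
    qed (use deg in \<open>simp add: coeff_eq_0\<close>)
  qed
qed

lemma reflect_poly_add_const:
  assumes "degree p > 0"
  shows "reflect_poly ([:a:] + p) = reflect_poly p + monom a (degree p)"
proof -
  have deg: "degree ([:a:] + p) = degree p"
    using assms by (intro degree_add_eq_right) auto
  show ?thesis
    by (auto intro!: poly_eqI simp: coeff_reflect_poly deg coeff_pCons split: nat.splits)
       (rule add.commute)
qed

text \<open>Both sides are \<open>z ^ (d * e) * f (g (1 / z))\<close>, where \<open>d\<close> and
  \<open>e\<close> are the degrees of \<open>f\<close> and \<open>g\<close>. The induction follows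
  Horner's scheme for \<open>f\<close>.\<close>

lemma reflect_poly_pcompose:
  fixes f g :: "'a::field poly"
  assumes "degree g > 0" "f \<noteq> 0"
  shows "fps_of_poly (reflect_poly (f \<circ>\<^sub>p g)) =
    (fps_of_poly (reflect_poly f) oo at_inf g) * fps_of_poly (reflect_poly g) ^ degree f"
  using assms(2)
proof (induction f)
  case (pCons a f)
  let ?R = "fps_of_poly (reflect_poly g)" and ?h = "at_inf g"
  have h0: "?h $ 0 = 0" using assms(1) by (rule at_inf_nth_0)
  have R0: "?R $ 0 \<noteq> 0" using assms(1) by auto
  show ?case
  proof (cases "f = 0")
    case True
    then show ?thesis by (simp add: fps_of_poly_const)
  next
    case False
    let ?d = "degree f"
    have nz: "g \<noteq> 0" "f \<circ>\<^sub>p g \<noteq> 0"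
      using assms(1) False by (auto simp: pcompose_eq_0_iff)
    have deg: "degree (g * (f \<circ>\<^sub>p g)) = Suc ?d * degree g"
      using nz by (simp add: degree_mult_eq degree_pcompose)
    \<comment> \<open>Products of equal powers of \<open>?h\<close> and \<open>?R\<close> become
      pure powers of \<open>fps_X\<close>, so the new constant \<open>a\<close> lands at the top
      power, as reflection demands.\<close>
    have hR: "?h * ?R = fps_X ^ degree g"
      using R0 by (simp add: at_inf_def mult.assoc inverse_mult_eq_1)
    have "reflect_poly (pCons a f) = reflect_poly ([:a:] + [:0, 1:] * f)"
      by simp
    also have "\<dots> = reflect_poly ([:0, 1:] * f) + monom a (Suc ?d)"
      using False by (subst reflect_poly_add_const) (auto simp: degree_mult_eq)
    also have "reflect_poly ([:0, 1:] * f) = reflect_poly f"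
      by (subst reflect_poly_mult) (simp add: reflect_poly_pCons')
    finally have refl: "reflect_poly (pCons a f) = reflect_poly f + monom a (Suc ?d)" .
    have "(fps_of_poly (reflect_poly (pCons a f)) oo ?h) * ?R ^ Suc ?d
        = (fps_of_poly (reflect_poly f) oo ?h) * ?R ^ Suc ?d + fps_const a * (?h ^ Suc ?d * ?R ^ Suc ?d)"
      unfolding refl fps_of_poly_add fps_of_poly_monom
      by (simp only: fps_compose_add_distrib fps_compose_mult_distrib[OF h0] fps_const_compose
          fps_X_power_compose[OF h0] distrib_right mult.assoc)
    also have "?h ^ Suc ?d * ?R ^ Suc ?d = fps_X ^ (Suc ?d * degree g)"
      by (simp only: power_mult_distrib[symmetric] hR power_mult[symmetric] mult.commute)
    also have "(fps_of_poly (reflect_poly f) oo ?h) * ?R ^ Suc ?d =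
        ?R * fps_of_poly (reflect_poly (f \<circ>\<^sub>p g))"
      using pCons.IH[OF False] by (simp add: mult_ac)
    also have "?R * fps_of_poly (reflect_poly (f \<circ>\<^sub>p g)) + fps_const a * fps_X ^ (Suc ?d * degree g)
        = fps_of_poly (reflect_poly ([:a:] + g * (f \<circ>\<^sub>p g)))"
      using assms(1) by (subst reflect_poly_add_const)
        (simp_all add: deg reflect_poly_mult fps_of_poly_add fps_of_poly_mult fps_of_poly_monom del: mult_Suc)
    finally show ?thesis using False by (simp add: pcompose_pCons)
  qed
qed simp

text \<open>Passing to \<open>1 / g (1 / z)\<close> is conjugation by inversion and hence respects
  composition; in power series this is the reflection identity, inverted.\<close>

lemma at_inf_pcompose:
  fixes f g :: "'a::field poly"
  assumes "degree g > 0" "f \<noteq> 0"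
  shows "at_inf (f \<circ>\<^sub>p g) = at_inf f oo at_inf g"
proof -
  let ?R = "fps_of_poly (reflect_poly g)" and ?h = "at_inf g" and ?F = "fps_of_poly (reflect_poly f)"
  have h0: "?h $ 0 = 0" using assms(1) by (rule at_inf_nth_0)
  have R0: "?R $ 0 \<noteq> 0" and F0: "?F $ 0 \<noteq> 0" using assms by auto
  have "at_inf (f \<circ>\<^sub>p g) = fps_X ^ (degree f * degree g) * inverse ((?F oo ?h) * ?R ^ degree f)"
    unfolding at_inf_def[of "f \<circ>\<^sub>p g"] reflect_poly_pcompose[OF assms] degree_pcompose ..
  also have "\<dots> = (fps_X ^ degree g * inverse ?R) ^ degree f * inverse (?F oo ?h)"
    by (simp add: fps_inverse_mult fps_inverse_power power_mult_distrib power_mult[symmetric] mult_ac)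
  also have "\<dots> = ?h ^ degree f * (inverse ?F oo ?h)"
    by (simp only: fps_inverse_compose[OF h0 F0]) (simp only: at_inf_def)
  also have "\<dots> = at_inf f oo ?h"
    by (simp add: at_inf_def[of f] fps_compose_mult_distrib[OF h0] fps_X_power_compose[OF h0])
  finally show ?thesis .
qed

section \<open>Coefficientwise solution of the Boettcher equation\<close>

lemma power_add_X_power_mult:
  fixes \<theta> h :: "'a::comm_ring_1 fps"
  assumes "m \<ge> 1"
  shows "\<exists>k. (\<theta> + fps_X ^ m * h) ^ d = \<theta> ^ d + fps_X ^ m * k \<and> k $ 0 = of_nat d * (\<theta> $ 0) ^ (d - 1) * h $ 0"
proof -
  let ?\<phi> = "\<theta> + fps_X ^ m * h"
  \<comment> \<open>The cofactor comes from factoring a difference of \<open>d\<close>-th powers; at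
    order 0 its \<open>d\<close> summands agree.\<close>
  define k where "k = h * (\<Sum>i<d. \<theta> ^ (d - Suc i) * ?\<phi> ^ i)"
  have "?\<phi> ^ d - \<theta> ^ d = fps_X ^ m * k"
    by (subst power_diff_sumr2) (simp add: k_def mult.assoc)
  then have "?\<phi> ^ d = \<theta> ^ d + fps_X ^ m * k"
    by (simp add: algebra_simps)
  moreover have "(\<Sum>i<d. (\<theta> ^ (d - Suc i) * ?\<phi> ^ i) $ 0) = (\<Sum>i<d. (\<theta> $ 0) ^ (d - 1))"
    using assms by (intro sum.cong) (auto simp: fps_power_zeroth power_0_left simp flip: power_add)
  then have "k $ 0 = of_nat d * (\<theta> $ 0) ^ (d - 1) * h $ 0"
    by (simp add: k_def fps_sum_nth mult_ac)
  ultimately show ?thesis by blast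
qed

text \<open>A change of \<open>\<theta>\<close> at order \<open>m\<close> affects the composition
  with \<open>F\<close> only from order \<open>(m + 1) * d\<close> on, which exceeds
  \<open>d + m\<close> since \<open>d \<ge> 2\<close>, while in the \<open>d\<close>-th power it
  shows at order \<open>d + m\<close> with factor \<open>d\<close>.\<close>

lemma boettcher_perturbation:
  fixes F \<theta> h :: "'a::field fps"
  assumes F: "subdegree F = d" "d \<ge> 2" and m: "m \<ge> 1" and \<theta>: "\<theta> $ 0 = 1" and n: "n \<le> d + m"
  shows "(fps_X * (\<theta> + fps_X ^ m * h) oo F) $ n = (fps_X * \<theta> oo F) $ n"
    and "((fps_X * (\<theta> + fps_X ^ m * h)) ^ d) $ n
      = ((fps_X * \<theta>) ^ d) $ n + (if n = d + m then of_nat d * h $ 0 else 0)"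
proof -
  have F0: "F $ 0 = 0" using F by (intro nth_less_subdegree_zero) auto
  have "fps_X * (\<theta> + fps_X ^ m * h) oo F = (fps_X * \<theta> oo F) + F ^ Suc m * (h oo F)"
    unfolding fps_X_power_compose[OF F0, symmetric] fps_compose_mult_distrib[OF F0, symmetric]
      fps_compose_add_distrib[symmetric] by (simp add: algebra_simps)
  moreover have "(F ^ Suc m * (h oo F)) $ n = 0"
  proof -
    have "m * 1 < m * d" using m F by (intro mult_strict_left_mono) auto
    then have "d + m < Suc m * d" by simp
    then have "n < Suc m * d" using n by linarith
    then have "(F ^ Suc m) $ i = 0" if "i \<le> n" for i
      using that F by (intro fps_pow_nth_below_subdegree) (auto simp del: mult_Suc)
    then show ?thesis by (auto simp: fps_mult_nth intro!: sum.neutral simp del: power_Suc)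
  qed
  ultimately show "(fps_X * (\<theta> + fps_X ^ m * h) oo F) $ n = (fps_X * \<theta> oo F) $ n" by simp
  obtain k where k: "(\<theta> + fps_X ^ m * h) ^ d = \<theta> ^ d + fps_X ^ m * k" "k $ 0 = of_nat d * h $ 0"
    using power_add_X_power_mult[OF m, of \<theta> h d] \<theta> by auto
  have "(fps_X * (\<theta> + fps_X ^ m * h)) ^ d = (fps_X * \<theta>) ^ d + fps_X ^ (d + m) * k"
    unfolding power_mult_distrib k(1) by (simp add: power_add distrib_left mult.assoc)
  then show "((fps_X * (\<theta> + fps_X ^ m * h)) ^ d) $ n
      = ((fps_X * \<theta>) ^ d) $ n + (if n = d + m then of_nat d * h $ 0 else 0)"
    using n k(2) by (auto simp: fps_X_power_mult_nth)
qed

text \<open>With \<open>\<psi> = fps_X * \<theta>\<close> and the lower coefficients known, the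
  equation at order \<open>d + k + 1\<close> is linear in the coefficient of \<open>\<theta>\<close>
  at order \<open>k + 1\<close>. Its factor is \<open>F $ d\<close> times \<open>d\<close>, nonzero
  by tameness.\<close>

lemma boettcher_exists:
  fixes F :: "'a::field fps"
  assumes F: "subdegree F = d" "d \<ge> 2" and tame: "of_nat d \<noteq> (0::'a)"
  shows "\<exists>\<psi>. \<psi> $ 0 = 0 \<and> \<psi> $ 1 = 1 \<and> \<psi> oo F = fps_const (F $ d) * \<psi> ^ d"
proof -
  define c where "c = F $ d"
  have F0: "F $ 0 = 0" using F by (intro nth_less_subdegree_zero) auto
  have "F \<noteq> 0" using F by auto
  then have c: "c \<noteq> 0" using F by (auto simp: c_def)
  define E where "E \<theta> n \<longleftrightarrow> (fps_X * \<theta> oo F) $ n = c * ((fps_X * \<theta>) ^ d) $ n" for \<theta> n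
  define P where "P k \<theta> \<longleftrightarrow> \<theta> $ 0 = 1 \<and> (\<forall>n\<le>d + k. E \<theta> n)" for k \<theta>
  \<comment> \<open>Dependent choice of approximations \<open>s k\<close>, correct through order
    \<open>d + k\<close>, each altering its predecessor only from order \<open>k + 1\<close>
    on.\<close>
  have "\<exists>s. \<forall>k. P k (s k) \<and> (\<exists>h. s (Suc k) = s k + fps_X ^ Suc k * h)"
  proof (rule dependent_nat_choice)
    have "F $ n = (if n = d then c else 0)" if "n \<le> d" for n
      using that F nth_less_subdegree_zero[of n F] by (auto simp: c_def)
    then have "P 0 1"
      by (simp add: P_def E_def fps_X_fps_compose_startby0[OF F0] fps_X_power_nth)
    then show "\<exists>\<theta>. P 0 \<theta>" ..
  next
    fix \<theta> k assume \<theta>: "P k \<theta>"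
    \<comment> \<open>The current defect at order \<open>d + k + 1\<close> divided by the linear
      factor.\<close>
    define \<delta> where "\<delta> = ((fps_X * \<theta> oo F) $ (d + Suc k) - c * ((fps_X * \<theta>) ^ d) $ (d + Suc k)) / (c * of_nat d)"
    let ?h = "fps_const \<delta>" and ?\<theta> = "\<theta> + fps_X ^ Suc k * fps_const \<delta>"
    have "\<theta> $ 0 = 1" using \<theta> by (simp add: P_def)
    note pert = boettcher_perturbation[OF F _ this, of "Suc k" _ ?h]
    have "E ?\<theta> n" if "n \<le> d + Suc k" for n
    proof (cases "n = d + Suc k")
      case True
      have "c * of_nat d * \<delta> = (fps_X * \<theta> oo F) $ (d + Suc k) - c * ((fps_X * \<theta>) ^ d) $ (d + Suc k)"
        using c tame by (simp add: \<delta>_def)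
      then show ?thesis
        using pert[of n] that True by (simp add: E_def algebra_simps del: power_Suc)
    next
      case False
      then have "E \<theta> n" using that \<theta> by (simp add: P_def)
      then show ?thesis
        using pert[of n] that False by (simp add: E_def del: power_Suc)
    qed
    moreover have "?\<theta> $ 0 = 1" using \<open>\<theta> $ 0 = 1\<close> by simp
    ultimately have "P (Suc k) ?\<theta>" by (simp add: P_def)
    then show "\<exists>\<theta>'. P (Suc k) \<theta>' \<and> (\<exists>h. \<theta>' = \<theta> + fps_X ^ Suc k * h)" by blast
  qed
  then obtain s where s: "\<And>k. P k (s k)" "\<And>k. \<exists>h. s (Suc k) = s k + fps_X ^ Suc k * h"
    by blast
  have stable: "s (k + j) $ i = s k $ i" if "i \<le> k" for i j k
  proof (induction j)
    case (Suc j)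
    obtain h where "s (Suc (k + j)) = s (k + j) + fps_X ^ Suc (k + j) * h" using s(2) by blast
    then show ?case using Suc that by (simp add: fps_X_power_mult_nth del: power_Suc)
  qed simp
  \<comment> \<open>The coefficients stabilize, so the diagonal is the limit of the
    \<open>s k\<close>.\<close>
  define \<theta> where "\<theta> = Abs_fps (\<lambda>n. s n $ n)"
  have \<theta>_nth: "\<theta> $ i = s k $ i" if "i \<le> k" for i k
    using stable[of i i "k - i"] that by (simp add: \<theta>_def)
  have "E \<theta> n" for n
  proof -
    have "s n $ 0 = 1" "E (s n) n" using s(1)[of n] by (auto simp: P_def)
    define h where "h = fps_shift (Suc n) (\<theta> - s n)"
    have "\<theta> = s n + fps_X ^ Suc n * h"
      by (rule fps_ext) (auto simp: h_def fps_X_power_mult_nth \<theta>_nth simp del: power_Suc)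
    then show ?thesis
      using boettcher_perturbation[OF F _ \<open>s n $ 0 = 1\<close>, of "Suc n" n h] \<open>E (s n) n\<close> F(2)
      by (simp add: E_def del: power_Suc)
  qed
  then have "fps_X * \<theta> oo F = fps_const (F $ d) * (fps_X * \<theta>) ^ d"
    by (intro fps_ext) (simp add: E_def c_def)
  moreover have "\<theta> $ 0 = 1" using \<theta>_nth[of 0 0] s(1)[of 0] by (simp add: P_def)
  ultimately show ?thesis by (intro exI[of _ "fps_X * \<theta>"]) auto
qed

text \<open>\<open>C g\<close> is \<open>at_inf g\<close> conjugated by a Boettcher series
  \<open>\<psi>\<close> of \<open>at_inf f\<close>. The functional equation makes \<open>C f\<close>
  a monomial, and \<open>C\<close> is injective because conjugation can be undone and
  \<open>at_inf\<close> is injective.\<close>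

lemma boettcher_coordinate:
  fixes f :: "'a::field poly"
  assumes "degree f \<ge> 2" "of_nat (degree f) \<noteq> (0::'a)"
  obtains C :: "'a poly \<Rightarrow> 'a fps" and c where
    "\<And>g h. degree g > 0 \<Longrightarrow> degree h > 0 \<Longrightarrow> C (g \<circ>\<^sub>p h) = C g oo C h"
    "\<And>g. degree g > 0 \<Longrightarrow> subdegree (C g) = degree g"
    "inj_on C {g. degree g > 0}"
    "c \<noteq> 0" "C f = fps_const c * fps_X ^ degree f"
proof -
  let ?d = "degree f"
  have "f \<noteq> 0" using assms by auto
  obtain \<psi> where \<psi>: "\<psi> $ 0 = 0" "\<psi> $ 1 = 1" "\<psi> oo at_inf f = fps_const (at_inf f $ ?d) * \<psi> ^ ?d"
    using boettcher_exists[OF subdegree_at_inf[OF \<open>f \<noteq> 0\<close>] assms] by blast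
  define \<phi> where "\<phi> = fps_inv \<psi>"
  have \<phi>0: "\<phi> $ 0 = 0" by (simp add: \<phi>_def fps_inv_def)
  have \<phi>\<psi>: "\<phi> oo \<psi> = fps_X" using \<psi> by (simp add: \<phi>_def fps_inv)
  have \<psi>\<phi>: "\<psi> oo \<phi> = fps_X" using \<psi> by (simp add: \<phi>_def fps_inv_right)
  define C where "C g = \<psi> oo at_inf g oo \<phi>" for g
  have C_hom: "C (g \<circ>\<^sub>p h) = C g oo C h" if "degree g > 0" "degree h > 0" for g h
  proof -
    have 0: "at_inf g $ 0 = 0" "at_inf h $ 0 = 0" "(\<psi> oo at_inf h) $ 0 = 0" "(at_inf h oo \<phi>) $ 0 = 0"
      using that \<psi> by (simp_all add: at_inf_nth_0)
    have "C g oo C h = \<psi> oo at_inf g oo (\<phi> oo (\<psi> oo (at_inf h oo \<phi>)))"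
      unfolding C_def by (simp add: fps_compose_assoc 0 \<psi> \<phi>0)
    also have "\<phi> oo (\<psi> oo (at_inf h oo \<phi>)) = at_inf h oo \<phi>"
      by (simp add: fps_compose_assoc 0 \<psi> \<phi>0 \<phi>\<psi>)
    also have "\<psi> oo at_inf g oo (at_inf h oo \<phi>) = C (g \<circ>\<^sub>p h)"
      using that unfolding C_def by (subst at_inf_pcompose) (auto simp: fps_compose_assoc 0 \<psi> \<phi>0)
    finally show ?thesis ..
  qed
  have C_inv: "at_inf g = \<phi> oo C g oo \<psi>" if "degree g > 0" for g
  proof -
    have 0: "at_inf g $ 0 = 0" "(\<psi> oo at_inf g) $ 0 = 0" "(C g) $ 0 = 0"
      using that \<psi> by (simp_all add: at_inf_nth_0 C_def)
    have "\<phi> oo C g oo \<psi> = \<phi> oo (\<psi> oo at_inf g oo (\<phi> oo \<psi>))"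
      unfolding C_def by (simp add: fps_compose_assoc 0 \<psi> \<phi>0)
    also have "\<dots> = at_inf g"
      by (simp add: \<phi>\<psi> fps_compose_assoc 0 \<psi> \<phi>0)
    finally show ?thesis ..
  qed
  have sub1: "subdegree \<psi> = 1"
    using \<psi> by (intro subdegreeI) auto
  have sub2: "subdegree \<phi> = 1"
    using arg_cong[OF \<psi>\<phi>, of subdegree] \<phi>0 by (simp add: sub1)
  have C_sub: "subdegree (C g) = degree g" if "degree g > 0" for g
  proof -
    have "g \<noteq> 0" using that by auto
    then show ?thesis
      using that by (simp add: C_def \<phi>0 at_inf_nth_0 sub1 sub2 subdegree_at_inf)
  qed
  have C_inj: "inj_on C {g. degree g > 0}"
  proof (rule inj_onI)
    fix g h assume "g \<in> {g. degree g > 0}" "h \<in> {g. degree g > 0}" "C g = C h"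
    then have "at_inf g = at_inf h" "g \<noteq> 0" "h \<noteq> 0" using C_inv by auto
    then show "g = h" using inj_onD[OF inj_on_at_inf] by blast
  qed
  have c: "at_inf f $ ?d \<noteq> 0"
  proof -
    have "at_inf f \<noteq> 0" using subdegree_at_inf[OF \<open>f \<noteq> 0\<close>] assms(1) by auto
    then show ?thesis using subdegree_at_inf[OF \<open>f \<noteq> 0\<close>] nth_subdegree_nonzero by metis
  qed
  have "C f = fps_const (at_inf f $ ?d) * (\<psi> oo \<phi>) ^ ?d"
    by (simp add: C_def \<psi>(3) fps_compose_mult_distrib[OF \<phi>0] fps_compose_power[OF \<phi>0])
  then have "C f = fps_const (at_inf f $ ?d) * fps_X ^ ?d" by (simp add: \<psi>\<phi>)
  then show thesis using C_hom C_sub C_inj c by (intro that[of C "at_inf f $ ?d"])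
qed

section \<open>Semigroups containing a nonlinear polynomial\<close>

lemma word_prod_snoc:
  "ws \<noteq> [] \<Longrightarrow> word_prod pcompose (ws @ [g]) = word_prod pcompose ws \<circ>\<^sub>p (g :: 'a::comm_semiring_1 poly)"
  by (subst word_prod_append) (auto simp: pcompose_assoc)

lemma pcompose_cancel_right:
  fixes p q r :: "'a::idom poly"
  assumes "degree r > 0" "p \<circ>\<^sub>p r = q \<circ>\<^sub>p r"
  shows "p = q"
  using pcompose_eq_0[of "p - q" r] assms by (simp add: pcompose_diff)

text \<open>Equal words end in the same letter, which right cancellation removes. Neither word is
  used up first, since composing a nonempty prefix with a letter strictly raises the degree.\<close>

lemma free_if_last_letter_determined:
  fixes l :: "bool \<Rightarrow> 'a::field poly"
  assumes S: "subsemigroup pcompose S" "\<And>b. l b \<in> S" and deg: "\<And>b. degree (l b) \<ge> 2"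
    and last: "\<And>bs cs. word_prod pcompose (map l bs @ [l False]) \<noteq> word_prod pcompose (map l cs @ [l True])"
  shows "contains_nonabelian_free_semigroup pcompose S"
proof (rule contains_nonabelian_free_semigroupI[OF pcompose_assoc S])
  let ?w = "\<lambda>bs. word_prod pcompose (map l bs)"
  have deg_w: "degree (?w bs) \<ge> 2" if "bs \<noteq> []" for bs
    using that
  proof (induction bs rule: list_nonempty_induct)
    case (cons b bs)
    have "2 * 1 \<le> degree (l b) * degree (?w bs)"
      using cons deg[of b] by (intro mult_mono) auto
    then show ?case using cons.hyps by (simp add: word_prod_Cons degree_pcompose)
  qed (simp add: deg)
  have snoc_eq: "?w (bs @ [b]) = ?w bs \<circ>\<^sub>p l b" if "bs \<noteq> []" for bs b
    using that by (simp add: word_prod_snoc)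
  have not_letter: "?w (bs @ [b]) \<noteq> l b" if "bs \<noteq> []" for bs b
  proof
    assume "?w (bs @ [b]) = l b"
    then have "degree (?w bs) * degree (l b) = degree (l b)"
      using that by (metis snoc_eq degree_pcompose)
    then show False using deg_w[OF that] deg[of b] by simp
  qed
  fix bs cs assume "bs \<noteq> []" "cs \<noteq> []" "?w bs = ?w cs"
  then show "bs = cs"
  proof (induction bs arbitrary: cs rule: rev_induct)
    case (snoc b bs)
    obtain c cs' where cs: "cs = cs' @ [c]"
      using snoc.prems(2) by (metis rev_exhaust)
    have eq: "?w (bs @ [b]) = ?w (cs' @ [c])" using snoc.prems(3) by (simp only: cs)
    have "b = c"
    proof (rule ccontr)
      assume "b \<noteq> c"
      then consider "b = False" "c = True" | "b = True" "c = False" by auto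
      then show False
        using eq last[of bs cs'] last[of cs' bs] by cases simp_all
    qed
    consider "bs = []" "cs' = []" | "bs = []" "cs' \<noteq> []" | "bs \<noteq> []" "cs' = []"
      | "bs \<noteq> []" "cs' \<noteq> []" by blast
    then show ?case
    proof cases
      case 1
      then show ?thesis using cs \<open>b = c\<close> by simp
    next
      case 2
      then show ?thesis using eq not_letter[of cs' c] \<open>b = c\<close> by simp
    next
      case 3
      then show ?thesis using eq not_letter[of bs b] \<open>b = c\<close> by simp
    next
      case 4
      then have "?w bs \<circ>\<^sub>p l b = ?w cs' \<circ>\<^sub>p l b"
        using eq \<open>b = c\<close> snoc_eq by simp
      then have "?w bs = ?w cs'"
        by (rule pcompose_cancel_right[rotated]) (use deg[of b] in linarith)
      then show ?thesis using snoc.IH[of cs'] 4 \<open>b = c\<close> cs by simp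
    qed
  qed simp
qed

text \<open>The correction in \<open>h\<close> enters through the linear term of the
  \<open>e\<close>-th power at exponent \<open>e * s + r\<close>, the correction in \<open>g\<close>
  only at \<open>s * (e + r)\<close>, which is larger since \<open>s \<ge> 2\<close>. So the
  coefficient at distance \<open>r\<close> comes from the inner series.\<close>

lemma compose_gap:
  fixes g h :: "'a::field fps"
  assumes g: "g = fps_const a * fps_X ^ e + fps_X ^ (e + r) * k"
    and h: "h = fps_const b * fps_X ^ s + fps_X ^ (s + r) * l"
    and s: "s \<ge> 2" and r: "r \<ge> 1"
  shows "\<exists>m. g oo h = fps_const (a * b ^ e) * fps_X ^ (e * s) + fps_X ^ (e * s + r) * m \<and>
    m $ 0 = a * of_nat e * b ^ (e - 1) * l $ 0"
proof -
  have h0: "h $ 0 = 0" using s by (simp add: h)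
  define t where "t = fps_const b + fps_X ^ r * l"
  have ht: "h = fps_X ^ s * t" by (simp add: h t_def power_add algebra_simps)
  obtain n where n: "t ^ e = fps_const b ^ e + fps_X ^ r * n" "n $ 0 = of_nat e * b ^ (e - 1) * l $ 0"
    using power_add_X_power_mult[OF r, of "fps_const b" l e] by (auto simp: t_def)
  \<comment> \<open>The delay \<open>q = (s - 1) * r\<close> with which the correction of
    \<open>g\<close> appears.\<close>
  obtain q where q: "s * (e + r) = e * s + r + q" "q > 0"
  proof
    show "s * (e + r) = e * s + r + (s - 1) * r" using s by (cases s) (auto simp: algebra_simps)
    show "(s - 1) * r > 0" using s r by simp
  qed
  let ?m = "fps_const a * n + fps_X ^ q * (t ^ (e + r) * (k oo h))"
  have "g oo h = fps_const a * h ^ e + h ^ (e + r) * (k oo h)"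
    by (simp add: g fps_compose_add_distrib fps_compose_mult_distrib[OF h0] fps_X_power_compose[OF h0])
  also have "h ^ e = fps_X ^ (e * s) * (fps_const b ^ e + fps_X ^ r * n)"
    by (simp add: ht power_mult_distrib n(1) power_mult[symmetric] mult.commute)
  also have "h ^ (e + r) = fps_X ^ (e * s + r + q) * t ^ (e + r)"
    by (simp only: ht power_mult_distrib power_mult[symmetric] q)
  finally have "g oo h = fps_const (a * b ^ e) * fps_X ^ (e * s) + fps_X ^ (e * s + r) * ?m"
    by (simp add: power_add algebra_simps fps_const_power flip: fps_const_mult)
  moreover have "?m $ 0 = a * of_nat e * b ^ (e - 1) * l $ 0"
    using q n(2) by (simp add: mult.assoc)
  ultimately show ?thesis by blast
qed

text \<open>A monomial inside multiplies all exponents by \<open>s\<close>, so the gap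
  \<open>r\<close> widens to \<open>r * s\<close>.\<close>

lemma compose_monomial_gap:
  fixes g :: "'a::field fps"
  assumes g: "g = fps_const a * fps_X ^ e + fps_X ^ (e + r) * k" and s: "s \<ge> 1"
  shows "g oo (fps_const b * fps_X ^ s) = fps_const (a * b ^ e) * fps_X ^ (e * s) +
    fps_X ^ (e * s + r * s) * (fps_const (b ^ (e + r)) * (k oo (fps_const b * fps_X ^ s)))"
proof -
  let ?h = "fps_const b * fps_X ^ s"
  have h0: "?h $ 0 = 0" using s by simp
  have pow: "?h ^ n = fps_const (b ^ n) * fps_X ^ (n * s)" for n
    by (simp add: power_mult_distrib fps_const_power power_mult[symmetric] mult.commute)
  have "g oo ?h = fps_const a * ?h ^ e + ?h ^ (e + r) * (k oo ?h)"
    by (simp add: g fps_compose_add_distrib fps_compose_mult_distrib[OF h0] fps_X_power_compose[OF h0])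
  also have "\<dots> = fps_const (a * b ^ e) * fps_X ^ (e * s) +
    fps_X ^ (e * s + r * s) * (fps_const (b ^ (e + r)) * (k oo ?h))"
    unfolding pow distrib_right[of e r s] by (simp only: fps_const_mult[symmetric] mult_ac)
  finally show ?thesis .
qed

lemma monomial_or_gap:
  fixes h :: "'a::field fps"
  assumes "h \<noteq> 0"
  obtains a where "a \<noteq> 0" "h = fps_const a * fps_X ^ subdegree h"
  | a r k where "a \<noteq> 0" "r \<ge> 1" "k $ 0 \<noteq> 0"
      "h = fps_const a * fps_X ^ subdegree h + fps_X ^ (subdegree h + r) * k"
proof -
  define e a where "e = subdegree h" and "a = h $ e"
  have a: "a \<noteq> 0" using assms by (simp add: a_def e_def)
  define h' where "h' = h - fps_const a * fps_X ^ e"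
  show thesis
  proof (cases "h' = 0")
    case True
    then show thesis using that(1)[OF a] by (simp add: h'_def e_def)
  next
    case False
    have "h' $ i = 0" if "i \<le> e" for i
      using that nth_less_subdegree_zero[of i h] by (auto simp: h'_def a_def e_def)
    then have "subdegree h' > e"
      using False by (metis linorder_not_less nth_subdegree_nonzero)
    then obtain r where r: "subdegree h' = e + r" "r \<ge> 1"
      by (metis less_imp_add_positive Suc_leI One_nat_def)
    have "h' = fps_X ^ (e + r) * fps_shift (e + r) h'"
      using subdegree_decompose[of h'] r by (simp add: mult.commute)
    moreover have "fps_shift (e + r) h' $ 0 \<noteq> 0"
      using False r by (metis add_0 fps_shift_nth nth_subdegree_nonzero)
    ultimately show thesis
      using that(2)[OF a r(2), of "fps_shift (e + r) h'"] by (simp add: h'_def e_def)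
  qed
qed

text \<open>
  In a coordinate in which \<open>f\<close> is a monomial, the second nonzero exponent of a word in \<open>f\<close> and a
  non-monomial \<open>g\<close> reveals whether the word ends in \<open>f\<close> or in \<open>g\<close>.
\<close>

lemma free_if_not_monomial:
  fixes S :: "'a::field poly set" and C :: "'a poly \<Rightarrow> 'a fps"
  assumes S: "subsemigroup pcompose S" "f \<in> S" "g \<in> S"
    and tame: "\<And>h. h \<in> S \<Longrightarrow> of_nat (degree h) \<noteq> (0::'a)"
    and deg: "degree f \<ge> 2"
    and C_hom: "\<And>g h. degree g > 0 \<Longrightarrow> degree h > 0 \<Longrightarrow> C (g \<circ>\<^sub>p h) = C g oo C h"
    and C_sub: "\<And>g. degree g > 0 \<Longrightarrow> subdegree (C g) = degree g"
    and Cf: "C f = fps_const c * fps_X ^ degree f" "c \<noteq> 0"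
    and g: "\<nexists>a. a \<noteq> 0 \<and> C g = fps_const a * fps_X ^ degree g"
  shows "contains_nonabelian_free_semigroup pcompose S"
proof -
  have pos: "degree h > 0" if "h \<in> S" for h
    using tame[OF that] by (cases "degree h = 0") auto
  have "C g \<noteq> 0" using C_sub[OF pos[OF S(3)]] pos[OF S(3)] by auto
  obtain a0 r0 k0 where g_gap: "a0 \<noteq> 0" "r0 \<ge> 1" "k0 $ 0 \<noteq> 0"
      "C g = fps_const a0 * fps_X ^ degree g + fps_X ^ (degree g + r0) * k0"
    by (rule monomial_or_gap[OF \<open>C g \<noteq> 0\<close>]) (use g C_sub[OF pos[OF S(3)]] in auto)
  \<comment> \<open>\<open>g\<close> itself may be linear; composing with \<open>f\<close> gives
    degree at least 2, as \<open>compose_gap\<close> requires of the inner series.\<close>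
  define v where "v = g \<circ>\<^sub>p f"
  have v: "v \<in> S" using S by (simp add: subsemigroup_def v_def)
  have deg_v: "degree v = degree g * degree f" by (simp add: v_def degree_pcompose)
  have "1 * 2 \<le> degree g * degree f" using deg pos[OF S(3)] by (intro mult_mono) auto
  then have "degree v \<ge> 2" by (simp add: deg_v)
  define r where "r = r0 * degree f"
  have "r \<ge> 1" using g_gap(2) deg by (simp add: r_def)
  have "C v = C g oo C f" using C_hom pos S by (simp add: v_def)
  also have "\<dots> = fps_const (a0 * c ^ degree g) * fps_X ^ degree v + fps_X ^ (degree v + r) *
      (fps_const (c ^ (degree g + r0)) * (k0 oo (fps_const c * fps_X ^ degree f)))"
    unfolding Cf r_def deg_v using deg by (intro compose_monomial_gap g_gap) auto
  finally have Cv_eq: "C v = \<dots>" .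
  obtain a k where Cv: "a \<noteq> 0" "k $ 0 \<noteq> 0"
      "C v = fps_const a * fps_X ^ degree v + fps_X ^ (degree v + r) * k"
    by (rule that[OF _ _ Cv_eq]) (use g_gap(1,3) Cf(2) in auto)
  \<comment> \<open>As \<open>k $ 0\<close> may be 0, this only says that further exponents are at
    least \<open>r\<close> above the first.\<close>
  let ?gap = "\<lambda>h b k. b \<noteq> 0 \<and> C h = fps_const b * fps_X ^ degree h + fps_X ^ (degree h + r) * k"
  \<comment> \<open>Appending \<open>v\<close> produces a nonzero coefficient at distance
    \<open>r\<close>; the factor \<open>degree h\<close> is nonzero by tameness.\<close>
  have comp_v: "\<exists>b l. ?gap (h \<circ>\<^sub>p v) b l \<and> l $ 0 \<noteq> 0" if h: "h \<in> S" "?gap h b m" for h b m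
  proof -
    obtain l where "C h oo C v = fps_const (b * a ^ degree h) * fps_X ^ (degree h * degree v) +
        fps_X ^ (degree h * degree v + r) * l" "l $ 0 = b * of_nat (degree h) * a ^ (degree h - 1) * k $ 0"
      using compose_gap[of "C h" b "degree h" r m "C v" a "degree v" k] h(2) Cv(3)
        \<open>degree v \<ge> 2\<close> \<open>r \<ge> 1\<close> by auto
    moreover have "C (h \<circ>\<^sub>p v) = C h oo C v" using C_hom pos v h(1) by simp
    ultimately show ?thesis
      using tame[OF h(1)] h(2) Cv(1,2)
      by (intro exI[of _ "b * a ^ degree h"] exI[of _ l]) (auto simp: degree_pcompose)
  qed
  \<comment> \<open>Appending \<open>f\<close> stretches gaps by \<open>degree f \<ge> 2\<close> and
    so clears the coefficient at distance \<open>r\<close>.\<close>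
  have comp_f: "\<exists>b l. ?gap (h \<circ>\<^sub>p f) b l \<and> l $ 0 = 0" if h: "h \<in> S" "?gap h b m" for h b m
  proof -
    let ?l = "fps_const (c ^ (degree h + r)) * (m oo (fps_const c * fps_X ^ degree f))"
    have "C h oo C f = fps_const (b * c ^ degree h) * fps_X ^ (degree h * degree f) +
        fps_X ^ (degree h * degree f + r * degree f) * ?l"
      unfolding Cf using deg h(2) by (intro compose_monomial_gap) auto
    also have "r * degree f = r + r * (degree f - 1)"
      using deg by (cases "degree f") auto
    finally have "C (h \<circ>\<^sub>p f) = fps_const (b * c ^ degree h) * fps_X ^ degree (h \<circ>\<^sub>p f) +
        fps_X ^ (degree (h \<circ>\<^sub>p f) + r) * (fps_X ^ (r * (degree f - 1)) * ?l)"
      using C_hom[OF pos[OF h(1)] pos[OF S(2)]] by (simp add: degree_pcompose power_add mult.assoc)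
    moreover have "(fps_X ^ (r * (degree f - 1)) * ?l) $ 0 = 0"
      using \<open>r \<ge> 1\<close> deg by simp
    ultimately show ?thesis using h(2) Cf(2) by (metis mult_eq_0_iff power_not_zero)
  qed
  have gap_f: "\<exists>b l. ?gap f b l \<and> l $ 0 = 0"
    using Cf by (intro exI[of _ c] exI[of _ 0]) auto
  have gap_v: "\<exists>b l. ?gap v b l \<and> l $ 0 \<noteq> 0" using Cv by blast
  have gap_word: "word_prod pcompose ws \<in> S \<and> (\<exists>b l. ?gap (word_prod pcompose ws) b l)"
    if "ws \<noteq> []" "set ws \<subseteq> {f, v}" for ws
    using that
  proof (induction ws rule: rev_nonempty_induct)
    case (single x)
    then show ?case using gap_f gap_v S(2) v by auto
  next
    case (snoc x xs)
    then have IH: "word_prod pcompose xs \<in> S" "\<exists>b l. ?gap (word_prod pcompose xs) b l" by auto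
    then have "word_prod pcompose xs \<circ>\<^sub>p x \<in> S"
      using S v snoc.prems by (auto simp: subsemigroup_def)
    moreover have "\<exists>b l. ?gap (word_prod pcompose xs \<circ>\<^sub>p x) b l"
      using IH comp_f comp_v snoc.prems by auto metis+
    ultimately show ?case using snoc.hyps by (simp add: word_prod_snoc)
  qed
  have nth_gap: "C h $ (degree h + r) = l $ 0" if "?gap h b l" for h b l
    using that \<open>r \<ge> 1\<close> by (auto simp: fps_X_power_mult_nth)
  have last_f: "C w $ (degree w + r) = 0" if w: "w = word_prod pcompose (ws @ [f])" "set ws \<subseteq> {f, v}" for w ws
  proof -
    have "\<exists>b l. ?gap w b l \<and> l $ 0 = 0"
    proof (cases "ws = []")
      case False
      obtain b l where "?gap (word_prod pcompose ws) b l" "word_prod pcompose ws \<in> S"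
        using gap_word[OF False w(2)] by blast
      then show ?thesis using comp_f w(1) False by (simp add: word_prod_snoc)
    qed (use w gap_f in simp)
    then show ?thesis using nth_gap by metis
  qed
  have last_v: "C w $ (degree w + r) \<noteq> 0" if w: "w = word_prod pcompose (ws @ [v])" "set ws \<subseteq> {f, v}" for w ws
  proof -
    have "\<exists>b l. ?gap w b l \<and> l $ 0 \<noteq> 0"
    proof (cases "ws = []")
      case False
      obtain b l where "?gap (word_prod pcompose ws) b l" "word_prod pcompose ws \<in> S"
        using gap_word[OF False w(2)] by blast
      then show ?thesis using comp_v w(1) False by (simp add: word_prod_snoc)
    qed (use w gap_v in simp)
    then show ?thesis using nth_gap by metis
  qed
  define l where "l b = (if b then v else f)" for b
  have sub: "set (map l bs) \<subseteq> {f, v}" for bs by (auto simp: l_def)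
  show ?thesis
  proof (rule free_if_last_letter_determined[OF S(1), of l])
    show "l b \<in> S" "degree (l b) \<ge> 2" for b
      using S v deg \<open>degree v \<ge> 2\<close> by (auto simp: l_def)
    show "word_prod pcompose (map l bs @ [l False]) \<noteq> word_prod pcompose (map l cs @ [l True])" for bs cs
      using last_f[OF _ sub, of _ bs] last_v[OF _ sub, of _ cs] by (metis l_def)
  qed
qed

section \<open>Words in two monomials of equal degree and base \<open>D\<close> expansions\<close>

fun bits_value :: "nat \<Rightarrow> bool list \<Rightarrow> nat" where
  "bits_value D [] = 0"
| "bits_value D (b # bs) = of_bool b + D * bits_value D bs"

lemma bits_value_inj:
  assumes "D \<ge> 2" "length bs = length cs" "bits_value D bs = bits_value D cs"
  shows "bs = cs"
  using assms(2,3)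
proof (induction bs cs rule: list_induct2)
  case (Cons b bs c cs)
  have "(of_bool b + D * bits_value D bs) mod D = (of_bool c + D * bits_value D cs) mod D"
    using Cons.prems by simp
  then have "of_bool b = (of_bool c :: nat)" using assms(1) by simp
  then have "b = c" by (cases b; cases c) simp_all
  then show ?case using Cons assms(1) by simp
qed simp

lemma compose_monomials:
  fixes a b :: "'a::field"
  assumes "n > 0"
  shows "(fps_const a * fps_X ^ m) oo (fps_const b * fps_X ^ n) = fps_const (a * b ^ m) * fps_X ^ (m * n)"
  using compose_monomial_gap[of "fps_const a * fps_X ^ m" a m 0 0 n b] assms by simp

text \<open>A word of length \<open>n\<close> is a monomial of degree \<open>D ^ n\<close>, which
  reveals \<open>n\<close>. Its coefficient is a power of \<open>\<alpha>\<close> depending only on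
  \<open>n\<close>, times \<open>\<rho>\<close> to the number whose base \<open>D\<close> digits
  mark the letters \<open>v\<close>, the outermost letter giving the lowest digit. Distinct words
  give distinct powers of \<open>\<rho>\<close>.\<close>

lemma free_if_monomial_ratio_not_root_of_unity:
  fixes S :: "'a::field poly set" and C :: "'a poly \<Rightarrow> 'a fps"
  assumes S: "subsemigroup pcompose S" "u \<in> S" "v \<in> S"
    and C_hom: "\<And>g h. degree g > 0 \<Longrightarrow> degree h > 0 \<Longrightarrow> C (g \<circ>\<^sub>p h) = C g oo C h"
    and deg: "degree u = D" "degree v = D" "D \<ge> 2"
    and Cu: "C u = fps_const \<alpha> * fps_X ^ D" and Cv: "C v = fps_const (\<alpha> * \<rho>) * fps_X ^ D"
    and nz: "\<alpha> \<noteq> 0" "\<rho> \<noteq> 0" and \<rho>: "\<And>n. n > 0 \<Longrightarrow> \<rho> ^ n \<noteq> 1"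
  shows "contains_nonabelian_free_semigroup pcompose S"
proof -
  define l where "l b = (if b then v else u)" for b
  let ?w = "\<lambda>bs. word_prod pcompose (map l bs)"
  have l: "l b \<in> S" "degree (l b) = D" "C (l b) = fps_const (\<alpha> * \<rho> ^ of_bool b) * fps_X ^ D" for b
    using S deg Cu Cv by (auto simp: l_def)
  have deg_w: "degree (?w bs) = D ^ length bs" if "bs \<noteq> []" for bs
    using that by (induction bs rule: list_nonempty_induct) (auto simp: l word_prod_Cons degree_pcompose)
  have Cw: "C (?w bs) = fps_const (\<alpha> ^ (\<Sum>i<length bs. D ^ i) * \<rho> ^ bits_value D bs) * fps_X ^ (D ^ length bs)"
    if "bs \<noteq> []" for bs
    using that
  proof (induction bs rule: list_nonempty_induct)
    case (single b)
    then show ?case by (simp add: l)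
  next
    case (cons b bs)
    let ?\<gamma> = "\<Sum>i<length bs. D ^ i" and ?\<epsilon> = "bits_value D bs"
    have "C (?w (b # bs)) = C (l b) oo C (?w bs)"
      using cons.hyps deg(3) l(2) deg_w by (simp add: word_prod_Cons C_hom)
    also have "\<dots> = fps_const ((\<alpha> * \<rho> ^ of_bool b) * (\<alpha> ^ ?\<gamma> * \<rho> ^ ?\<epsilon>) ^ D) * fps_X ^ (D * D ^ length bs)"
      unfolding l cons.IH using deg(3) by (intro compose_monomials) auto
    also have "(\<alpha> * \<rho> ^ of_bool b) * (\<alpha> ^ ?\<gamma> * \<rho> ^ ?\<epsilon>) ^ D
        = \<alpha> ^ (1 + D * ?\<gamma>) * \<rho> ^ (of_bool b + D * ?\<epsilon>)"
      by (simp only: power_mult_distrib power_add power_one_right power_mult[symmetric] mult_ac)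
    also have "1 + D * ?\<gamma> = (\<Sum>i<length (b # bs). D ^ i)"
      using sum.lessThan_Suc_shift[of "\<lambda>i. D ^ i" "length bs"] by (simp add: sum_distrib_left)
    finally show ?case by simp
  qed
  show ?thesis
  proof (rule contains_nonabelian_free_semigroupI[OF pcompose_assoc S(1) l(1)])
    fix bs cs assume ne: "bs \<noteq> []" "cs \<noteq> []" and eq: "?w bs = ?w cs"
    have "D ^ length bs = D ^ length cs" using ne eq deg_w by metis
    then have len: "length bs = length cs" using deg(3) by simp
    have "\<alpha> ^ (\<Sum>i<length bs. D ^ i) * \<rho> ^ bits_value D bs = \<alpha> ^ (\<Sum>i<length bs. D ^ i) * \<rho> ^ bits_value D cs"
      using arg_cong[OF eq, of "\<lambda>p. C p $ (D ^ length bs)"] Cw[OF ne(1)] Cw[OF ne(2)] len by simp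
    then have "\<rho> ^ bits_value D bs = \<rho> ^ bits_value D cs" using nz by simp
    then have "bits_value D bs = bits_value D cs"
      using power_inj_if_not_root_of_unity[of \<rho>] nz(2) \<rho> by blast
    then show "bs = cs" by (rule bits_value_inj[OF deg(3) len])
  qed
qed

text \<open>Every element becomes a monomial whose coefficient \<open>A g\<close> satisfies
  \<open>A g ^ K = c ^ ((degree g - 1) * N0)\<close> for fixed \<open>K\<close> and
  \<open>N0\<close>. So each degree carries at most \<open>K\<close> elements, and the degree of a
  word depends only on its letter counts.\<close>

lemma nonlinear_alternative:
  fixes G :: "'a::field poly set"
  defines "S \<equiv> word_prod pcompose ` nonempty_words G"
  assumes "finite G"
    and tame: "\<And>h. h \<in> S \<Longrightarrow> of_nat (degree h) \<noteq> (0::'a)"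
    and f: "f \<in> S" "degree f \<ge> 2"
    and not_free: "\<not> contains_nonabelian_free_semigroup pcompose S"
  shows "\<exists>M k. \<forall>n. growth pcompose G n \<le> M * (n + 1) ^ k"
proof -
  have S: "subsemigroup pcompose S"
    unfolding S_def by (rule subsemigroup_words) (simp add: pcompose_assoc)
  have GS: "G \<subseteq> S" unfolding S_def by (rule generators_subset_words)
  have pos: "degree h > 0" if "h \<in> S" for h
    using tame[OF that] by (cases "degree h = 0") auto
  obtain C :: "'a poly \<Rightarrow> 'a fps" and c where
    C_hom: "\<And>g h. degree g > 0 \<Longrightarrow> degree h > 0 \<Longrightarrow> C (g \<circ>\<^sub>p h) = C g oo C h"
    and C_sub: "\<And>g. degree g > 0 \<Longrightarrow> subdegree (C g) = degree g"
    and C_inj: "inj_on C {g. degree g > 0}"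
    and c: "c \<noteq> 0" and Cf: "C f = fps_const c * fps_X ^ degree f"
    using boettcher_coordinate[OF f(2) tame[OF f(1)]] by blast
  define d where "d = degree f"
  define A where "A g = C g $ degree g" for g
  have C_eq: "A g \<noteq> 0 \<and> C g = fps_const (A g) * fps_X ^ degree g" if g: "g \<in> S" for g
  proof -
    obtain a where "a \<noteq> 0" "C g = fps_const a * fps_X ^ degree g"
      using free_if_not_monomial[OF S f(1) g tame f(2) C_hom C_sub Cf c] not_free by blast
    then show ?thesis by (simp add: A_def)
  qed
  have A_comp: "A (g \<circ>\<^sub>p h) = A g * A h ^ degree g" if "g \<in> S" "h \<in> S" for g h
  proof -
    have "C (g \<circ>\<^sub>p h) = fps_const (A g * A h ^ degree g) * fps_X ^ (degree g * degree h)"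
      using C_hom[of g h] C_eq[of g] C_eq[of h] pos[of g] pos[of h] that
        compose_monomials[of "degree h" "A g" "degree g" "A h"] by simp
    then show ?thesis by (simp add: A_def[of "g \<circ>\<^sub>p h"] degree_pcompose)
  qed
  have A_f: "A f = c" using Cf by (simp add: A_def)
  have "\<exists>N>0. (A g ^ (d - 1)) ^ N = (c ^ (degree g - 1)) ^ N" if g: "g \<in> S" for g
  proof -
    define e where "e = degree g"
    \<comment> \<open>The coefficient of \<open>f \<circ>\<^sub>p g\<close> divided by that of
      \<open>g \<circ>\<^sub>p f\<close>; both have degree \<open>d * e\<close>.\<close>
    define \<rho> where "\<rho> = A g ^ (d - 1) / c ^ (e - 1)"
    have e: "e > 0" using pos[OF g] by (simp add: e_def)
    have d: "d \<ge> 2" using f(2) by (simp add: d_def)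
    have \<rho>0: "\<rho> \<noteq> 0" using C_eq[OF g] c by (simp add: \<rho>_def)
    have fg: "f \<circ>\<^sub>p g \<in> S" "g \<circ>\<^sub>p f \<in> S" using S f(1) g by (auto simp: subsemigroup_def)
    have deg: "degree (g \<circ>\<^sub>p f) = d * e" "degree (f \<circ>\<^sub>p g) = d * e"
      by (simp_all add: degree_pcompose d_def e_def)
    have "d * e \<ge> 2 * 1" using d e by (intro mult_mono) auto
    have "C (g \<circ>\<^sub>p f) = fps_const (A g * c ^ e) * fps_X ^ (d * e)"
      using C_eq[OF fg(2)] A_comp[OF g f(1)] deg by (simp add: A_f e_def)
    moreover have "C (f \<circ>\<^sub>p g) = fps_const (A g * c ^ e * \<rho>) * fps_X ^ (d * e)"
    proof -
      have "A g * c ^ e * \<rho> = (A g * A g ^ (d - 1)) * (c ^ e / c ^ (e - 1))" by (simp add: \<rho>_def)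
      also have "A g * A g ^ (d - 1) = A g ^ d" using d by (cases d) auto
      also have "c ^ e / c ^ (e - 1) = c" using e c by (cases e) auto
      finally have "A g * c ^ e * \<rho> = c * A g ^ d" by (simp add: mult.commute)
      then show ?thesis using C_eq[OF fg(1)] A_comp[OF f(1) g] deg by (simp add: A_f d_def)
    qed
    ultimately have "\<exists>n>0. \<rho> ^ n = 1"
      using free_if_monomial_ratio_not_root_of_unity[OF S fg(2,1) C_hom deg, of "A g * c ^ e" \<rho>]
        not_free C_eq[OF g] c \<rho>0 \<open>d * e \<ge> 2 * 1\<close> by auto
    then obtain n where "n > 0" "\<rho> ^ n = 1" by blast
    then show ?thesis
      using c by (intro exI[of _ n]) (auto simp: \<rho>_def power_divide e_def)
  qed
  then obtain N where N: "\<And>g. g \<in> S \<Longrightarrow> N g > 0 \<and> (A g ^ (d - 1)) ^ N g = (c ^ (degree g - 1)) ^ N g"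
    by metis
  \<comment> \<open>A common exponent for the finitely many generators, which then serves for all
    words.\<close>
  define N0 where "N0 = (\<Prod>g\<in>G. N g)"
  have "N0 > 0" using N GS by (auto simp: N0_def intro!: prod_pos)
  have A_G: "(A g ^ (d - 1)) ^ N0 = (c ^ (degree g - 1)) ^ N0" if "g \<in> G" for g
  proof -
    have "N g dvd N0" using \<open>finite G\<close> that unfolding N0_def by (rule dvd_prodI)
    then obtain j where "N0 = N g * j" by (auto elim: dvdE)
    then show ?thesis using N[of g] GS that by (auto simp: power_mult)
  qed
  let ?K = "(d - 1) * N0"
  \<comment> \<open>The exponents of \<open>c\<close> add up along a word because
    \<open>(e - 1) + (e' - 1) * e = e * e' - 1\<close>.\<close>
  have word: "word_prod pcompose ws \<in> S \<and>
      A (word_prod pcompose ws) ^ ?K = c ^ ((degree (word_prod pcompose ws) - 1) * N0)"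
    if "ws \<noteq> []" "set ws \<subseteq> G" for ws
    using that
  proof (induction ws rule: list_nonempty_induct)
    case (single g)
    then show ?case using A_G[of g] GS by (auto simp: power_mult)
  next
    case (cons g ws)
    let ?w = "word_prod pcompose ws"
    have g: "g \<in> S" "g \<in> G" and w: "?w \<in> S" "A ?w ^ ?K = c ^ ((degree ?w - 1) * N0)"
      using cons GS by auto
    have "A (g \<circ>\<^sub>p ?w) ^ ?K = A g ^ ?K * (A ?w ^ ?K) ^ degree g"
      unfolding A_comp[OF g(1) w(1)] power_mult_distrib by (simp only: power_mult[symmetric] mult.commute)
    also have "A g ^ ?K = c ^ ((degree g - 1) * N0)" using A_G[OF g(2)] by (simp add: power_mult)
    also have "c ^ ((degree g - 1) * N0) * (A ?w ^ ?K) ^ degree g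
        = c ^ (((degree g - 1) + (degree ?w - 1) * degree g) * N0)"
      unfolding w(2) by (simp add: algebra_simps flip: power_mult power_add)
    also have "(degree g - 1) + (degree ?w - 1) * degree g = degree (g \<circ>\<^sub>p ?w) - 1"
      using pos[OF g(1)] pos[OF w(1)] by (cases "degree ?w") (auto simp: degree_pcompose mult.commute)
    finally show ?case using cons.hyps w g S by (auto simp: word_prod_Cons subsemigroup_def)
  qed
  \<comment> \<open>Candidates for words with letter counts \<open>m\<close>: the degree is fixed
    and the coefficient is a root of one equation.\<close>
  define B where "B m = {w \<in> S. degree w = (\<Prod>g\<in>G. degree g ^ m g) \<and>
      A w ^ ?K = c ^ ((degree w - 1) * N0)}" for m
  have "growth pcompose G n \<le> ?K * (n + 1) ^ card G" for n
  proof (rule growth_le_if_counted[OF \<open>finite G\<close>, where B = B])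
    fix ws assume "ws \<in> nonempty_words G"
    then have ws: "ws \<noteq> []" "set ws \<subseteq> G" by (auto simp: nonempty_words_def)
    have "degree (word_prod pcompose ws) = (\<Prod>g\<in>G. degree g ^ count_list ws g)"
      by (rule hom_word_prod[OF \<open>finite G\<close> S GS _ ws]) (simp add: degree_pcompose)
    then have "word_prod pcompose ws \<in> B (restrict (count_list ws) G)"
      using word[OF ws] by (simp add: B_def)
    then show "\<exists>m. (\<forall>i\<in>G. m i \<le> length ws) \<and> word_prod pcompose ws \<in> B (restrict m G)"
      by (intro exI[of _ "count_list ws"]) (auto simp: count_le_length)
  next
    fix m
    define D where "D = (\<Prod>g\<in>G. degree g ^ m g)"
    have "?K > 0" using f(2) \<open>N0 > 0\<close> by (simp add: d_def)
    note roots = card_roots_power_eq[OF this, of "c ^ ((D - 1) * N0)"]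
    have sub: "A ` B m \<subseteq> {z. z ^ ?K = c ^ ((D - 1) * N0)}" by (auto simp: B_def D_def)
    have inj: "inj_on A (B m)"
    proof (rule inj_onI)
      fix x y assume xy: "x \<in> B m" "y \<in> B m" "A x = A y"
      then have "C x = C y" using C_eq[of x] C_eq[of y] by (simp add: B_def)
      moreover have "x \<in> S" "y \<in> S" using xy by (auto simp: B_def)
      ultimately show "x = y" using pos[of x] pos[of y] inj_onD[OF C_inj, of x y] by blast
    qed
    show "finite (B m)" using finite_subset[OF sub roots(1)] inj finite_imageD by blast
    show "card (B m) \<le> ?K"
      using card_mono[OF roots(1) sub] card_image[OF inj] roots(2) by linarith
  qed
  then show ?thesis by blast
qed

section \<open>Affine semigroups\<close>

lemma degree_1_poly_eq: "degree p = 1 \<Longrightarrow> p = [:coeff p 0, coeff p 1:]"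
  by (rule poly_eqI) (auto simp: coeff_pCons coeff_eq_0 split: nat.splits)

lemma coeff_pcompose_affine:
  fixes g h :: "'a::field poly"
  assumes "degree g = 1" "degree h = 1"
  shows "coeff (g \<circ>\<^sub>p h) 1 = coeff g 1 * coeff h 1"
    and "coeff (g \<circ>\<^sub>p h) 0 = coeff g 0 + coeff g 1 * coeff h 0"
proof -
  have g: "g = [:coeff g 0, coeff g 1:]" using degree_1_poly_eq[OF assms(1)] .
  show "coeff (g \<circ>\<^sub>p h) 1 = coeff g 1 * coeff h 1"
    using lead_coeff_comp[of h g] assms by (simp add: degree_pcompose)
  show "coeff (g \<circ>\<^sub>p h) 0 = coeff g 0 + coeff g 1 * coeff h 0"
    by (subst g) (simp add: mult.commute)
qed

text \<open>The constant term of a word of length \<open>n\<close> is \<open>s\<close> times a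
  geometric sum depending only on \<open>n\<close>, plus \<open>t - s\<close> times the sum of the
  \<open>A ^ i\<close> over the positions \<open>i\<close> of \<open>v\<close>. Two distinct words
  of equal length with the same value would make \<open>A\<close> a root of a sign
  polynomial.\<close>

lemma free_affine:
  fixes u v :: "'a::field poly"
  assumes S: "subsemigroup pcompose S" "u \<in> S" "v \<in> S"
    and deg: "degree u = 1" "degree v = 1"
    and slope: "coeff u 1 = A" "coeff v 1 = A" and ne: "coeff u 0 \<noteq> coeff v 0"
    and A: "\<And>p. sign_poly p \<Longrightarrow> int_poly_eval p A \<noteq> 0"
  shows "contains_nonabelian_free_semigroup pcompose S"
proof -
  define l where "l b = (if b then v else u)" for b
  define E :: "bool list \<Rightarrow> int poly" where "E bs = Poly (map of_bool bs)" for bs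
  let ?w = "\<lambda>bs. word_prod pcompose (map l bs)"
  define s t where "s = coeff u 0" and "t = coeff v 0"
  have l: "l b \<in> S" "degree (l b) = 1" "coeff (l b) 1 = A" "coeff (l b) 0 = s + of_bool b * (t - s)" for b
    using S deg slope by (auto simp: l_def s_def t_def)
  have deg_w: "degree (?w bs) = 1" if "bs \<noteq> []" for bs
    using that by (induction bs rule: list_nonempty_induct) (auto simp: l word_prod_Cons degree_pcompose)
  have w1: "coeff (?w bs) 1 = A ^ length bs" if "bs \<noteq> []" for bs
    using that
  proof (induction bs rule: list_nonempty_induct)
    case (cons b bs)
    then show ?case
      using coeff_pcompose_affine(1)[OF l(2) deg_w[OF cons.hyps(1)], of b] l(3)[of b] by (simp add: word_prod_Cons)
  qed (use l in simp)
  have w0: "coeff (?w bs) 0 = s * (\<Sum>i<length bs. A ^ i) + (t - s) * int_poly_eval (E bs) A"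
    if "bs \<noteq> []" for bs
    using that
  proof (induction bs rule: list_nonempty_induct)
    case (single b)
    then show ?case by (simp add: l E_def int_poly_eval_pCons)
  next
    case (cons b bs)
    have "coeff (?w (b # bs)) 0 = s + of_bool b * (t - s) + A * coeff (?w bs) 0"
      using coeff_pcompose_affine(2)[OF l(2) deg_w[OF cons.hyps(1)], of b] cons.hyps l(3,4)[of b]
      by (simp add: word_prod_Cons)
    also have "\<dots> = s * (1 + (\<Sum>i<length bs. A * A ^ i)) +
        (t - s) * (of_bool b + A * int_poly_eval (E bs) A)"
      by (simp add: cons.IH algebra_simps sum_distrib_left)
    also have "1 + (\<Sum>i<length bs. A * A ^ i) = (\<Sum>i<length (b # bs). A ^ i)"
      using sum.lessThan_Suc_shift[of "\<lambda>i. A ^ i" "length bs"] by simp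
    also have "of_bool b + A * int_poly_eval (E bs) A = int_poly_eval (E (b # bs)) A"
      by (simp add: E_def int_poly_eval_pCons)
    finally show ?case .
  qed
  have E_coeff: "coeff (E bs) i = (if i < length bs then of_bool (bs ! i) else 0)" for bs i
    by (simp add: E_def coeff_Poly_eq nth_default_def)
  show ?thesis
  proof (rule contains_nonabelian_free_semigroupI[OF pcompose_assoc S(1) l(1)])
    fix bs cs assume ne': "bs \<noteq> []" "cs \<noteq> []" and eq: "?w bs = ?w cs"
    have len: "length bs = length cs"
    proof (rule ccontr)
      assume neq: "length bs \<noteq> length cs"
      \<comment> \<open>Words of different lengths with equal slope make \<open>A\<close> a root of
        a difference of two monomials, again a sign polynomial.\<close>
      let ?p = "monom 1 (length bs) - monom 1 (length cs) :: int poly"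
      have "coeff ?p (length bs) = 1" using neq by simp
      then have "?p \<noteq> 0" by (metis coeff_0 zero_neq_one)
      then have "sign_poly ?p" by (auto simp: sign_poly_def)
      moreover have "map_poly of_int ?p = monom 1 (length bs) - (monom 1 (length cs) :: 'a poly)"
        by (rule poly_eqI) (simp add: coeff_map_poly)
      then have "int_poly_eval ?p A = A ^ length bs - A ^ length cs"
        by (simp add: poly_monom)
      moreover have "A ^ length bs = A ^ length cs"
        using w1[OF ne'(1)] w1[OF ne'(2)] eq by simp
      ultimately show False using A[of ?p] by simp
    qed
    have "(t - s) * int_poly_eval (E bs) A = (t - s) * int_poly_eval (E cs) A"
      using w0[OF ne'(1)] w0[OF ne'(2)] unfolding eq len by (metis add_left_cancel)
    then have "int_poly_eval (E bs) A = int_poly_eval (E cs) A"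
      using ne by (simp add: s_def t_def)
    moreover have "int_poly_eval (E bs) A = int_poly_eval (E bs - E cs) A + int_poly_eval (E cs) A"
      by (simp flip: int_poly_eval_add)
    ultimately have "int_poly_eval (E bs - E cs) A = 0" by simp
    then have "\<not> sign_poly (E bs - E cs)" using A by blast
    moreover have "coeff (E bs - E cs) i \<in> {-1, 0, 1}" for i
      by (simp add: E_coeff)
    ultimately have "E bs = E cs" by (auto simp: sign_poly_def)
    show "bs = cs"
    proof (rule nth_equalityI[OF len])
      fix i assume "i < length bs"
      then show "bs ! i = cs ! i"
        using arg_cong[OF \<open>E bs = E cs\<close>, of "\<lambda>p. coeff p i"] len by (auto simp: E_coeff of_bool_def split: if_splits)
    qed
  qed
qed

lemma affine_alternative:
  fixes G :: "'a::field poly set"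
  defines "S \<equiv> word_prod pcompose ` nonempty_words G"
  assumes "finite G"
    and deg: "\<And>h. h \<in> S \<Longrightarrow> degree h = 1"
    and not_free: "\<not> contains_nonabelian_free_semigroup pcompose S"
  shows "\<exists>M k. \<forall>n. growth pcompose G n \<le> M * (n + 1) ^ k"
proof -
  have S: "subsemigroup pcompose S"
    unfolding S_def by (rule subsemigroup_words) (simp add: pcompose_assoc)
  have GS: "G \<subseteq> S" unfolding S_def by (rule generators_subset_words)
  have comp: "g \<circ>\<^sub>p h \<in> S" if "g \<in> S" "h \<in> S" for g h
    using S that by (simp add: subsemigroup_def)
  have word_S: "word_prod pcompose ws \<in> S" if "ws \<noteq> []" "set ws \<subseteq> G" for ws
    unfolding S_def using that by (auto simp: nonempty_words_def)
  have slope: "coeff (word_prod pcompose ws) 1 = (\<Prod>g\<in>G. coeff g 1 ^ count_list ws g)"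
    if "ws \<noteq> []" "set ws \<subseteq> G" for ws
    using hom_word_prod[OF \<open>finite G\<close> S GS _ that, of "\<lambda>g. coeff g 1"] coeff_pcompose_affine(1) deg by blast
  have slope_nz: "coeff g 1 \<noteq> 0" if "g \<in> S" for g
    using deg[OF that] by (metis degree_0 leading_coeff_0_iff zero_neq_one)
  show ?thesis
  proof (cases "\<forall>g\<in>G. \<exists>n>0. coeff g 1 ^ n = 1")
    case True
    then obtain N where N: "\<And>g. g \<in> G \<Longrightarrow> N g > 0 \<and> coeff g 1 ^ N g = 1" by metis
    define N0 where "N0 = (\<Prod>g\<in>G. N g)"
    have "N0 > 0" using N by (auto simp: N0_def intro!: prod_pos)
    define Z where "Z = {z::'a. z ^ N0 = 1}"
    have Z: "finite Z" "card Z \<le> N0" using card_roots_power_eq[OF \<open>N0 > 0\<close>, of 1] by (auto simp: Z_def)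
    have G_Z: "coeff g 1 \<in> Z" if "g \<in> G" for g
    proof -
      have "N g dvd N0" using \<open>finite G\<close> that unfolding N0_def by (rule dvd_prodI)
      then show ?thesis using N[OF that] by (auto simp: Z_def power_mult elim!: dvdE)
    qed
    define I where "I = Z \<times> G"
    have "finite I" using Z \<open>finite G\<close> by (simp add: I_def)
    \<comment> \<open>\<open>m (z, g)\<close> counts the letters \<open>g\<close> preceded by a
      prefix of slope \<open>z\<close>, the empty prefix having slope 1; each such letter
      contributes \<open>z\<close> times the constant term of \<open>g\<close>.\<close>
    define T where "T m = (\<Sum>i\<in>I. of_nat (m i) * (fst i * coeff (snd i) 0))" for m :: "'a \<times> 'a poly \<Rightarrow> nat"
    have word: "coeff (word_prod pcompose ws) 1 \<in> Z \<and>
        (\<exists>m. (\<forall>i. m i \<le> length ws) \<and> coeff (word_prod pcompose ws) 0 = T m)"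
      if "ws \<noteq> []" "set ws \<subseteq> G" for ws
      using that
    proof (induction ws rule: rev_nonempty_induct)
      case (single g)
      have "(1, g) \<in> I" using single by (simp add: I_def Z_def)
      have "T (\<lambda>i. if i = (1, g) then 1 else 0) = (\<Sum>i\<in>I. if i = (1, g) then fst i * coeff (snd i) 0 else 0)"
        unfolding T_def by (rule sum.cong) auto
      also have "\<dots> = coeff g 0" using \<open>(1, g) \<in> I\<close> \<open>finite I\<close> by simp
      finally have "T (\<lambda>i. if i = (1, g) then 1 else 0) = coeff g 0" .
      then show ?case using G_Z single by (auto intro!: exI[of _ "\<lambda>i. if i = (1, g) then 1 else 0"])
    next
      case (snoc g ws)
      let ?w = "word_prod pcompose ws" and ?i = "(coeff (word_prod pcompose ws) 1, g)"
      obtain m where m: "\<And>i. m i \<le> length ws" "coeff ?w 0 = T m" and "coeff ?w 1 \<in> Z"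
        using snoc by auto
      have g: "g \<in> G" "set ws \<subseteq> G" using snoc.prems by auto
      have deg': "degree ?w = 1" "degree g = 1" using word_S[OF snoc.hyps(1) g(2)] deg g GS by auto
      have "?i \<in> I" using g \<open>coeff ?w 1 \<in> Z\<close> by (simp add: I_def)
      let ?m = "m(?i := Suc (m ?i))"
      have "T ?m = (\<Sum>i\<in>I. of_nat (m i) * (fst i * coeff (snd i) 0) +
          (if i = ?i then fst i * coeff (snd i) 0 else 0))"
        unfolding T_def by (intro sum.cong) (auto simp: algebra_simps)
      also have "\<dots> = T m + coeff ?w 1 * coeff g 0"
        unfolding sum.distrib T_def using \<open>finite I\<close> \<open>?i \<in> I\<close> by simp
      finally have "coeff (?w \<circ>\<^sub>p g) 0 = T ?m"
        using coeff_pcompose_affine(2)[OF deg'] m(2) by simp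
      moreover have "\<forall>i. ?m i \<le> length (ws @ [g])"
        using m(1) by (auto simp: le_SucI)
      moreover have "coeff (?w \<circ>\<^sub>p g) 1 \<in> Z"
        using coeff_pcompose_affine(1)[OF deg'] \<open>coeff ?w 1 \<in> Z\<close> G_Z[OF g(1)]
        by (simp add: Z_def power_mult_distrib)
      ultimately show ?case using snoc.hyps by (metis word_prod_snoc)
    qed
    have "growth pcompose G n \<le> N0 * (n + 1) ^ card I" for n
    proof (rule growth_le_if_counted[OF \<open>finite I\<close>, where B = "\<lambda>m. (\<lambda>z. [:T m, z:]) ` Z"])
      fix ws assume "ws \<in> nonempty_words G"
      then have ws: "ws \<noteq> []" "set ws \<subseteq> G" by (auto simp: nonempty_words_def)
      let ?w = "word_prod pcompose ws"
      obtain m where m: "\<forall>i. m i \<le> length ws" "coeff ?w 0 = T m" using word[OF ws] by blast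
      have "T (restrict m I) = T m" unfolding T_def by (intro sum.cong) auto
      then have "?w = [:T (restrict m I), coeff ?w 1:]"
        using degree_1_poly_eq[OF deg[OF word_S[OF ws]]] m by simp
      then have "?w \<in> (\<lambda>z. [:T (restrict m I), z:]) ` Z"
        using word[OF ws] by blast
      then show "\<exists>m. (\<forall>i\<in>I. m i \<le> length ws) \<and> ?w \<in> (\<lambda>z. [:T (restrict m I), z:]) ` Z"
        using m(1) by blast
    qed (use Z card_image_le[OF Z(1)] le_trans in \<open>blast+\<close>)
    then show ?thesis by blast
  next
    case False
    then obtain f where f: "f \<in> G" "\<And>n. n > 0 \<Longrightarrow> coeff f 1 ^ n \<noteq> 1" by blast
    define a where "a = coeff f 1"
    have "a \<noteq> 1" using f(2)[of 1] by (simp add: a_def)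
    \<comment> \<open>The fixed point of \<open>f\<close>, available because
      \<open>a \<noteq> 1\<close>.\<close>
    define p where "p = coeff f 0 / (1 - a)"
    have poly_affine: "poly g x = coeff g 0 + coeff g 1 * x" if "g \<in> S" for g x
      by (subst degree_1_poly_eq[OF deg[OF that]]) (simp add: mult.commute)
    have fp: "poly f p = p"
      using poly_affine[of f p] f(1) GS \<open>a \<noteq> 1\<close> by (auto simp: p_def a_def field_simps)
    show ?thesis
    proof (cases "\<forall>g\<in>G. poly g p = p")
      case True
      have fixed: "poly (word_prod pcompose ws) p = p" if "ws \<noteq> []" "set ws \<subseteq> G" for ws
        using that True by (induction ws rule: list_nonempty_induct) (auto simp: word_prod_Cons poly_pcompose)
      \<comment> \<open>An affine map fixing \<open>p\<close> is determined by its slope, and the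
        slope of a word by its letter counts.\<close>
      define s where "s m = (\<Prod>g\<in>G. coeff g 1 ^ m g)" for m :: "'a poly \<Rightarrow> nat"
      have "growth pcompose G n \<le> 1 * (n + 1) ^ card G" for n
      proof (rule growth_le_if_counted[OF \<open>finite G\<close>, where B = "\<lambda>m. {[:p - s m * p, s m:]}"])
        fix ws assume "ws \<in> nonempty_words G"
        then have ws: "ws \<noteq> []" "set ws \<subseteq> G" by (auto simp: nonempty_words_def)
        let ?w = "word_prod pcompose ws" and ?m = "restrict (count_list ws) G"
        have "coeff ?w 1 = s ?m" unfolding s_def slope[OF ws] by (intro prod.cong) auto
        moreover from this have "coeff ?w 0 = p - s ?m * p"
          using fixed[OF ws] poly_affine[OF word_S[OF ws], of p] by (simp add: algebra_simps)
        ultimately have "?w = [:p - s ?m * p, s ?m:]"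
          using degree_1_poly_eq[OF deg[OF word_S[OF ws]]] by simp
        then show "\<exists>m. (\<forall>i\<in>G. m i \<le> length ws) \<and> ?w \<in> {[:p - s (restrict m G) * p, s (restrict m G):]}"
          by (intro exI[of _ "count_list ws"]) (auto simp: count_le_length)
      qed auto
      then show ?thesis by blast
    next
      case False
      then obtain g where g: "g \<in> G" "poly g p \<noteq> p" by blast
      define c where "c = coeff g 1"
      have nz: "a \<noteq> 0" "c \<noteq> 0" using slope_nz f(1) g(1) GS by (auto simp: a_def c_def)
      \<comment> \<open>Contrapositive of the root-of-unity criterion, since \<open>a\<close> is not
        a root of unity.\<close>
      obtain k where k: "k \<ge> 1" "\<And>q. sign_poly q \<Longrightarrow> int_poly_eval q (a ^ k * c) \<noteq> 0"
        using root_of_unity_if_sign_poly_roots[OF nz] f(2) unfolding a_def by blast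
      \<comment> \<open>The \<open>k\<close>-th iterate of \<open>f\<close>; starting at 1 avoids
        the identity, which need not lie in \<open>S\<close>.\<close>
      have "\<exists>h\<in>S. coeff h 1 = a ^ k \<and> poly h p = p"
        using k(1)
      proof (induction k rule: nat_induct_at_least)
        case base
        then show ?case using f(1) GS fp by (auto simp: a_def)
      next
        case (Suc k)
        then obtain h where h: "h \<in> S" "coeff h 1 = a ^ k" "poly h p = p" by blast
        have "f \<in> S" using f(1) GS by blast
        then show ?case
          using h comp[OF \<open>f \<in> S\<close> h(1)] coeff_pcompose_affine(1)[OF deg deg, of f h] fp
          by (intro bexI[of _ "f \<circ>\<^sub>p h"]) (auto simp: a_def poly_pcompose)
      qed
      then obtain h where h: "h \<in> S" "coeff h 1 = a ^ k" "poly h p = p" by blast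
      have "g \<in> S" using g(1) GS by blast
      note uv = comp[OF h(1) \<open>g \<in> S\<close>] comp[OF \<open>g \<in> S\<close> h(1)]
      have slopes: "coeff (h \<circ>\<^sub>p g) 1 = a ^ k * c" "coeff (g \<circ>\<^sub>p h) 1 = a ^ k * c"
        using coeff_pcompose_affine(1)[OF deg deg, OF h(1) \<open>g \<in> S\<close>]
          coeff_pcompose_affine(1)[OF deg deg, OF \<open>g \<in> S\<close> h(1)] h(2)
        by (simp_all add: c_def mult.commute)
      \<comment> \<open>Failure to commute, measured at \<open>p\<close>: \<open>h\<close> fixes
        \<open>p\<close> and scales the offset \<open>poly g p - p\<close> by \<open>a ^ k\<close>,
        which is not 1.\<close>
      have "poly (h \<circ>\<^sub>p g) p - poly (g \<circ>\<^sub>p h) p = (a ^ k - 1) * (poly g p - p)"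
      proof -
        have "coeff h 0 = p - a ^ k * p"
          using poly_affine[OF h(1), of p] h(2,3) by (simp add: algebra_simps)
        then have "poly h (poly g p) = p - a ^ k * p + a ^ k * poly g p"
          using poly_affine[OF h(1), of "poly g p"] h(2) by simp
        then show ?thesis by (simp add: poly_pcompose h(3) algebra_simps)
      qed
      moreover have "a ^ k \<noteq> 1" using f(2)[of k] k(1) by (simp add: a_def)
      ultimately have "poly (h \<circ>\<^sub>p g) p \<noteq> poly (g \<circ>\<^sub>p h) p" using g(2) by auto
      then have "coeff (h \<circ>\<^sub>p g) 0 \<noteq> coeff (g \<circ>\<^sub>p h) 0"
        using poly_affine[OF uv(1), of p] poly_affine[OF uv(2), of p] slopes by auto
      then have "contains_nonabelian_free_semigroup pcompose S"
        using free_affine[OF S uv deg[OF uv(1)] deg[OF uv(2)] slopes _ k(2)] by blast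
      then show ?thesis using not_free by blast
    qed
  qed
qed

section \<open>The alternative\<close>

text \<open>A constant letter absorbs everything to its right, so a word containing one equals a
  constant generator or a word in nonconstant generators followed by a constant. The three summands
  count words without constants, single generators, and such composites.\<close>

lemma growth_constants:
  fixes G :: "'a::field poly set"
  assumes "finite G"
  defines "G1 \<equiv> {g \<in> G. degree g > 0}"
  assumes bound: "\<And>n. growth pcompose G1 n \<le> M * (n + 1) ^ k"
  shows "growth pcompose G n \<le> (M + card G + M * card G) * (n + 1) ^ k"
proof -
  let ?W = "word_prod pcompose ` {ws \<in> nonempty_words G1. length ws \<le> n}"
  let ?c = "\<lambda>(w, c). w \<circ>\<^sub>p c"
  have fin: "finite ?W" using assms(1) by (intro finite_imageI finite_words_le) (simp add: G1_def)
  have absorb: "c \<circ>\<^sub>p p = c" if "degree c = 0" for c p :: "'a poly"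
    using that by (auto elim: degree_eq_zeroE)
  have *: "(ws \<in> nonempty_words G1) \<or> word_prod pcompose ws \<in> G \<or>
      (\<exists>vs\<in>nonempty_words G1. \<exists>c\<in>G. length vs \<le> length ws \<and> word_prod pcompose ws = word_prod pcompose vs \<circ>\<^sub>p c)"
    if "ws \<noteq> []" "set ws \<subseteq> G" for ws
    using that
  proof (induction ws rule: list_nonempty_induct)
    case (single g)
    then show ?case by simp
  next
    case (cons g ws)
    let ?w = "word_prod pcompose ws"
    have g: "g \<in> G" "set ws \<subseteq> G" using cons.prems by auto
    have w: "word_prod pcompose (g # ws) = g \<circ>\<^sub>p ?w" using cons.hyps by (simp add: word_prod_Cons)
    show ?case
    proof (cases "degree g = 0")
      case True
      then show ?thesis using w absorb g(1) by simp
    next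
      case False
      then have g1: "g \<in> G1" using g by (simp add: G1_def)
      consider "ws \<in> nonempty_words G1" | "?w \<in> G"
        | vs c where "vs \<in> nonempty_words G1" "c \<in> G" "length vs \<le> length ws" "?w = word_prod pcompose vs \<circ>\<^sub>p c"
        using cons.IH g(2) by blast
      then show ?thesis
      proof cases
        case 1
        then show ?thesis using g1 by (auto simp: nonempty_words_def)
      next
        case 2
        then show ?thesis
          using w g1 by (intro disjI2 bexI[of _ "[g]"] bexI[of _ ?w]) (auto simp: nonempty_words_def)
      next
        case 3
        then show ?thesis
          using w g1 by (intro disjI2 bexI[of _ "g # vs"] bexI[of _ c])
            (auto simp: nonempty_words_def word_prod_Cons pcompose_assoc)
      qed
    qed
  qed
  have "word_prod pcompose ` {ws \<in> nonempty_words G. length ws \<le> n} \<subseteq> ?W \<union> G \<union> ?c ` (?W \<times> G)"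
  proof clarify
    fix ws assume ws: "ws \<in> nonempty_words G" "length ws \<le> n"
      "word_prod pcompose ws \<notin> ?c ` (?W \<times> G)" "word_prod pcompose ws \<notin> G"
    consider "ws \<in> nonempty_words G1" | vs c where "vs \<in> nonempty_words G1" "c \<in> G"
        "length vs \<le> length ws" "word_prod pcompose ws = word_prod pcompose vs \<circ>\<^sub>p c"
      using *[of ws] ws by (auto simp: nonempty_words_def)
    then show "word_prod pcompose ws \<in> ?W"
    proof cases
      case 2
      then have "word_prod pcompose ws \<in> ?c ` (?W \<times> G)"
        using ws(2) by (intro image_eqI[of _ _ "(word_prod pcompose vs, c)"]) auto
      then show ?thesis using ws(3) by blast
    qed (use ws in auto)
  qed
  then have "growth pcompose G n \<le> card (?W \<union> G \<union> ?c ` (?W \<times> G))"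
    unfolding growth_def using fin assms(1) by (intro card_mono) auto
  also have "\<dots> \<le> card ?W + card G + card (?c ` (?W \<times> G))"
    by (meson add_mono card_Un_le le_refl le_trans)
  also have "\<dots> \<le> card ?W + card G + card ?W * card G"
    using card_image_le[of "?W \<times> G" ?c] fin assms(1) by (simp add: card_cartesian_product)
  also have "card ?W = growth pcompose G1 n" by (simp add: growth_def)
  also have "growth pcompose G1 n + card G + growth pcompose G1 n * card G
      \<le> M * (n + 1) ^ k + card G * (n + 1) ^ k + M * (n + 1) ^ k * card G"
    using bound[of n] by (intro add_mono mult_mono) auto
  also have "\<dots> = (M + card G + M * card G) * (n + 1) ^ k" by (simp add: algebra_simps)
  finally show ?thesis .
qed

theorem theorem1p4:
  fixes S :: "'a::field poly set"
  assumes "subsemigroup pcompose S"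
    and "\<exists>G. finite G \<and> generates pcompose G S"
    and "\<forall>f\<in>S. CHAR('a) > 0 \<longrightarrow> \<not> CHAR('a) dvd degree f"
  shows "polynomially_bounded_growth pcompose S \<or> contains_nonabelian_free_semigroup pcompose S"
proof (rule disjCI)
  assume not_free: "\<not> contains_nonabelian_free_semigroup pcompose S"
  have assoc: "\<And>p q r. p \<circ>\<^sub>p (q \<circ>\<^sub>p r) = p \<circ>\<^sub>p q \<circ>\<^sub>p (r :: 'a poly)" by (rule pcompose_assoc)
  obtain G where G: "finite G" "generates pcompose G S" using assms(2) by blast
  \<comment> \<open>Constants occur only in characteristic zero, as a positive characteristic
    divides the degree 0. They are split off because both alternatives below need positive
    degrees.\<close>
  define G1 where "G1 = {g \<in> G. degree g > 0}"
  define S1 where "S1 = word_prod pcompose ` nonempty_words G1"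
  have "finite G1" using G(1) by (simp add: G1_def)
  have S: "S = word_prod pcompose ` nonempty_words G"
    using G(2) hull_eq_words[OF assoc] by (simp add: generates_def)
  have "S1 \<subseteq> S" unfolding S S1_def by (auto simp: nonempty_words_def G1_def)
  have pos: "degree (word_prod pcompose ws) > 0" if "ws \<noteq> []" "set ws \<subseteq> G1" for ws
    using that
    by (induction ws rule: list_nonempty_induct) (auto simp: G1_def word_prod_Cons degree_pcompose)
  have tame: "of_nat (degree h) \<noteq> (0::'a)" if "h \<in> S1" for h
  proof (cases "CHAR('a) = 0")
    case True
    have "degree h > 0" using that pos by (auto simp: S1_def nonempty_words_def)
    then show ?thesis using True by (simp add: of_nat_eq_0_iff_char_dvd)
  next
    case False
    then show ?thesis using that \<open>S1 \<subseteq> S\<close> assms(3) by (auto simp: of_nat_eq_0_iff_char_dvd)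
  qed
  have not_free1: "\<not> contains_nonabelian_free_semigroup pcompose S1"
    using not_free \<open>S1 \<subseteq> S\<close> unfolding contains_nonabelian_free_semigroup_def by blast
  have "\<exists>M k. \<forall>n. growth pcompose G1 n \<le> M * (n + 1) ^ k"
  proof (cases "\<exists>f\<in>S1. degree f \<ge> 2")
    case True
    then show ?thesis
      using nonlinear_alternative[OF \<open>finite G1\<close>] tame not_free1 unfolding S1_def by blast
  next
    case False
    have "degree h = 1" if "h \<in> S1" for h
    proof -
      have "degree h > 0" using that pos by (auto simp: S1_def nonempty_words_def)
      moreover have "\<not> degree h \<ge> 2" using False that by blast
      ultimately show ?thesis by linarith
    qed
    then show ?thesis
      using affine_alternative[OF \<open>finite G1\<close>] not_free1 unfolding S1_def by blast
  qed
  then obtain M k where "\<And>n. growth pcompose G1 n \<le> M * (n + 1) ^ k" by blast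
  then have "\<And>n. growth pcompose G n \<le> (M + card G + M * card G) * (n + 1) ^ k"
    unfolding G1_def by (rule growth_constants[OF G(1)])
  then show "polynomially_bounded_growth pcompose S"
    by (rule polynomially_bounded_growthI[OF assoc G])
qed

end
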